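(* Consider the online resource allocation problem with $T$ items, $m$ supply nodes, $d$ resources with capacities $b_1,\dots,b_d$, and item distribution $\mathcal{D}$. Let $\varepsilon\in(0,0.001]$ be such that $$b_k \;\ge\; 1024\cdot \log\Big(\frac{2dT}{\varepsilon}\Big)\cdot\frac{\log^3(1/\varepsilon)}{\varepsilon^2}\,A_{jk}$$ for all $j\in\{1,\dots,m\}$, all $k\in\{1,\dots,d\}$ and every consumption matrix $A=(A_{jk})$ in the support of $\mathcal{D}$ (so that the inequality holds for every $A^t_{jk}$, $t\in\{1,\dots,T\}$). Then the single-sample OSO algorithm, run with an equivariant solver, achieves $$\mathbb{E}\Big[\sum_{t=1}^T r^t\cdot \overline{x}^t\Big]\;\ge\;(1-\varepsilon)\,\mathbb{E}[\mathrm{OPT}].$$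
   Context: Online resource allocation problem. There are $m$ supply nodes ($j\in\mathcal{J}=\{1,\dots,m\}$) and $d$ resources ($k\in\mathcal{K}=\{1,\dots,d\}$); resource $k$ has deterministic capacity $b_k\ge 0$, and $b=(b_1,\dots,b_d)$. Items $t=1,\dots,T$ arrive one at a time. Item $t$ is described by $\xi^t=(r^t,A^t)$, where $r^t\in\mathbb{R}^m$ is a vector of rewards and $A^t\in\mathbb{R}_{\ge 0}^{m\times d}$ is a matrix of resource consumptions. The $\xi^1,\dots,\xi^T$ are i.i.d. from a known distribution $\mathcal{D}$ (with integrable rewards). Let $\Delta=\{x\in\{0,1\}^m:\sum_{j}x_j\le 1\}$. The perfect-information optimum is the random variable $$\mathrm{OPT}=\max\Big\{\sum_{t=1}^T r^t\cdot x^t\;:\;\sum_{t=1}^T (A^t)^\top x^t\le b,\; x^1,\dots,x^T\in\Delta\Big\}.$$ Single-sample OSO algorithm. For $t=1,\dots,T$: observe $\xi^t$; draw one fresh sample path $\widetilde\xi^{t+1}_t,\dots,\widetilde\xi^{T}_t$, with $\widetilde\xi^\tau_t=(\widetilde r^\tau_t,\widetilde A^\tau_t)$, i.i.d. from $\mathcal{D}$ and independent of everything else; use the solver to compute an optimal solution $(\widetilde x^t,\dots,\widetilde x^T)$ of $$\max\Big\{ r^t\cdot x^t+\sum_{\tau=t+1}^T \widetilde r^\tau_t\cdot x^\tau : \sum_{\tau=1}^{t-1}(A^\tau)^\top\overline x^\tau+(A^t)^\top x^t+\sum_{\tau=t+1}^T(\widetilde A^\tau_t)^\top x^\tau\le b,\;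 x^t,\dots,x^T\in\Delta\Big\};$$ implement $\overline x^t=\widetilde x^t$ irrevocably and discard the rest. Equivariant solver. An exact solver for integer programs $\max\{\sum_{i=1}^s r^i\cdot x^i:\sum_{i=1}^s (A^i)^\top x^i\le b',\,x^i\in\Delta\}$ is equivariant if permuting the items permutes the solution in the same way: if it returns $(x^1,\dots,x^s)$ on the list of items $(r^1,A^1),\dots,(r^s,A^s)$, then for every permutation $\pi$ of $\{1,\dots,s\}$ it returns $(x^{\pi(1)},\dots,x^{\pi(s)})$ on the list $(r^{\pi(1)},A^{\pi(1)}),\dots,(r^{\pi(s)},A^{\pi(s)})$. The solver may use internal randomness (fresh and independent at each call, e.g. to break ties between identical items), in which case this is understood as equality in distribution. $\log$ is the natural logarithm. *)

theory Defs
  imports "HOL-Probability.Probability" "HOL-Combinatorics.Permutations"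
begin

text \<open>
  The supply nodes are the elements of the finite type \<open>'m\<close>, the resources those of \<open>'d\<close>.
  An item is a pair of a reward vector and a consumption matrix whose entry \<open>A $ j $ k\<close> is
  the consumption of resource \<open>k\<close> at node \<open>j\<close>.
\<close>

type_synonym ('m, 'd) item = "(real ^ 'm) \<times> (real ^ 'd ^ 'm)"

definition nonneg_item :: "('m::finite, 'd::finite) item \<Rightarrow> bool" where
  "nonneg_item \<xi> \<longleftrightarrow> (\<forall>j k. 0 \<le> snd \<xi> $ j $ k)"

definition Delta :: "(real ^ 'm::finite) set" where
  "Delta = {x. (\<forall>j. x $ j \<in> {0, 1}) \<and> (\<Sum>j\<in>UNIV. x $ j) \<le> 1}"

definition assignments :: "nat \<Rightarrow> (real ^ 'm::finite) list set" where
  "assignments s = {xs. length xs = s \<and> set xs \<subseteq> Delta}"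

definition reward :: "('m::finite, 'd::finite) item list \<Rightarrow> (real ^ 'm) list \<Rightarrow> real" where
  "reward items xs = (\<Sum>i<length items. fst (items ! i) \<bullet> (xs ! i))"

definition consumption ::
    "('m::finite, 'd::finite) item list \<Rightarrow> (real ^ 'm) list \<Rightarrow> real ^ 'd" where
  "consumption items xs = (\<Sum>i<length items. transpose (snd (items ! i)) *v (xs ! i))"

definition feasible ::
    "('m::finite, 'd::finite) item list \<Rightarrow> real ^ 'd \<Rightarrow> (real ^ 'm) list set" where
  "feasible items c =
     {xs \<in> assignments (length items). \<forall>k. consumption items xs $ k \<le> c $ k}"

definition opt_value :: "('m::finite, 'd::finite) item list \<Rightarrow> real ^ 'd \<Rightarrow> real" where
  "opt_value items c = Max (reward items ` feasible items c)"

text \<open>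
  A randomised solver maps a list of items and a capacity vector to the distribution of its
  output.  Since outputs range over the finite set \<open>assignments s\<close>, a \<open>pmf\<close> is no restriction.
\<close>

type_synonym ('m, 'd) solver = "('m, 'd) item list \<Rightarrow> real ^ 'd \<Rightarrow> (real ^ 'm) list pmf"

definition valid_instance :: "('m::finite, 'd::finite) item list \<Rightarrow> real ^ 'd \<Rightarrow> bool" where
  "valid_instance items c \<longleftrightarrow> (\<forall>\<xi>\<in>set items. nonneg_item \<xi>) \<and> feasible items c \<noteq> {}"

text \<open>
  On instances that are not valid, the output is only required to lie in the finite set of
  assignments; it is otherwise arbitrary.
\<close>

definition exact_solver :: "('m::finite, 'd::finite) solver \<Rightarrow> bool" where
  "exact_solver S \<longleftrightarrow>
     (\<forall>items c. set_pmf (S items c) \<subseteq> assignments (length items)) \<and>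
     (\<forall>items c. valid_instance items c \<longrightarrow>
        (\<forall>xs\<in>set_pmf (S items c). is_arg_max (reward items) (\<lambda>ys. ys \<in> feasible items c) xs))"

text \<open>\<open>permute_list p [x\<^sub>0, \<dots>, x\<^sub>s]\<close> is \<open>[x\<^bsub>p 0\<^esub>, \<dots>, x\<^bsub>p s\<^esub>]\<close>.\<close>

definition equivariant_solver :: "('m::finite, 'd::finite) solver \<Rightarrow> bool" where
  "equivariant_solver S \<longleftrightarrow>
     (\<forall>items c p. valid_instance items c \<and> p permutes {..<length items} \<longrightarrow>
        S (permute_list p items) c = map_pmf (permute_list p) (S items c))"

text \<open>
  The output distribution is a measurable function of the instance, so that the decisions of
  the algorithm are random variables.
\<close>

definition measurable_solver :: "('m::finite, 'd::finite) solver \<Rightarrow> bool" where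
  "measurable_solver S \<longleftrightarrow>
     (\<forall>s xs. (\<lambda>(f, c). pmf (S (map f [0..<s]) c) xs)
        \<in> borel_measurable ((\<Pi>\<^sub>M i\<in>{..<s}. borel) \<Otimes>\<^sub>M borel))"

text \<open>
  All items that are ever drawn, as one i.i.d. family indexed by pairs \<open>(t, \<tau>)\<close> with
  \<open>1 \<le> t \<le> \<tau> \<le> T\<close>: \<open>\<omega> (t, t)\<close> is the item arriving at time \<open>t\<close>, and for \<open>\<tau> > t\<close>,
  \<open>\<omega> (t, \<tau>)\<close> is the item simulated for time \<open>\<tau>\<close> in the sample path drawn at time \<open>t\<close>.
\<close>

definition item_space ::
    "('m::finite, 'd::finite) item measure \<Rightarrow> nat \<Rightarrow> (nat \<times> nat \<Rightarrow> ('m, 'd) item) measure" where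
  "item_space D T = (\<Pi>\<^sub>M i\<in>{(t, \<tau>). 1 \<le> t \<and> t \<le> \<tau> \<and> \<tau> \<le> T}. D)"

definition arrivals :: "nat \<Rightarrow> (nat \<times> nat \<Rightarrow> ('m, 'd) item) \<Rightarrow> ('m, 'd) item list" where
  "arrivals n \<omega> = map (\<lambda>t. \<omega> (t, t)) [1..<Suc n]"

text \<open>
  The distribution, over the solver's internal randomness and for fixed items \<open>\<omega>\<close>, of the first
  \<open>n\<close> decisions of the single-sample algorithm.
\<close>

fun oso :: "('m::finite, 'd::finite) solver \<Rightarrow> real ^ 'd \<Rightarrow> nat
    \<Rightarrow> (nat \<times> nat \<Rightarrow> ('m, 'd) item) \<Rightarrow> nat \<Rightarrow> (real ^ 'm) list pmf" where
  "oso S b T \<omega> 0 = return_pmf []"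
| "oso S b T \<omega> (Suc n) =
     do {
       xs \<leftarrow> oso S b T \<omega> n;
       ys \<leftarrow> S (map (\<lambda>\<tau>. \<omega> (Suc n, \<tau>)) [Suc n..<Suc T])
              (b - consumption (arrivals n \<omega>) xs);
       return_pmf (xs @ [hd ys])
     }"

definition expected_oso :: "('m::finite, 'd::finite) item measure \<Rightarrow> ('m, 'd) solver
    \<Rightarrow> real ^ 'd \<Rightarrow> nat \<Rightarrow> real" where
  "expected_oso D S b T =
     (\<integral>\<omega>. (\<integral>xs. reward (arrivals T \<omega>) xs \<partial>measure_pmf (oso S b T \<omega> T)) \<partial>item_space D T)"

definition expected_opt ::
    "('m::finite, 'd::finite) item measure \<Rightarrow> real ^ 'd \<Rightarrow> nat \<Rightarrow> real" where
  "expected_opt D b T = (\<integral>\<omega>. opt_value (arrivals T \<omega>) b \<partial>item_space D T)"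

definition measure_support :: "'a::topological_space measure \<Rightarrow> 'a set" where
  "measure_support M = {x. \<forall>U. open U \<and> x \<in> U \<longrightarrow> emeasure M U > 0}"

end

theory Submission
  imports Defs
begin

text \<open>
  Write \<open>s = T - t + 1\<close> for the number of items still to come when item \<open>t\<close> is treated, and
  \<open>g\<^sub>s(c)\<close> for the expected optimum of \<open>s\<close> fresh items with capacity \<open>c\<close> (\<open>mean_opt\<close>). The arriving
  item and the simulated ones are i.i.d. and independent of the remaining capacity \<open>c\<close>, and the
  solver treats them symmetrically. Hence the arriving item contributes in expectation exactly
  the fraction \<open>1/s\<close> of the reward of the whole sampled solution and of its consumption
  (\<open>solved_first\<close>). The first fact says that the algorithm earns \<open>g\<^sub>s(c)/s\<close> in this step
  (\<open>reward_step\<close>). The second says that it consumes at most \<open>c/s\<close> on average, so that the remaining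
  capacity per remaining item, \<open>c/s\<close>, has no downward drift.

  Measure resource \<open>k\<close> in units in which its capacity is \<open>M\<close> and no item needs more than \<open>1\<close>; the
  hypothesis allows \<open>M = 1024 L l\<^sup>3 / \<epsilon>\<^sup>2\<close> with \<open>L = ln (2dT/\<epsilon>)\<close> and \<open>l = ln (1/\<epsilon>)\<close>. The
  exponential moments of \<open>- c/s\<close> can be followed backwards in time (\<open>potential_step\<close>,
  \<open>potential_chain\<close>), which gives a Chernoff bound (\<open>capacity_concentration\<close>): except with probability at most
  \<open>d exp (- 2 L)\<close>, every remaining capacity is at least \<open>(1 - \<eta>) s/T\<close> times its initial value, as
  soon as \<open>\<eta>\<^sup>2 M s/T \<ge> 16 L\<close>.

  It remains to compare \<open>g\<^sub>s((1 - \<eta>) (s/T) b)\<close> with \<open>g\<^sub>T(b)\<close>, the expectation of \<open>OPT\<close>. Take an optimal solution for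
  \<open>T\<close> items and keep each item independently with probability \<open>(1 - 3\<eta>) s/T\<close>. If at most \<open>s\<close>
  items are kept and these fit into the reduced capacity, then they bound the optimum of \<open>s\<close> items
  from below. Conditionally on keeping a given item this fails with probability at most
  \<open>(d + 1) exp (- 2 L)\<close>, by another Chernoff bound (\<open>sample_tail\<close>). So
  \<open>g\<^sub>s \<ge> (1 - 3\<eta>) (s/T) g\<^sub>T(b)\<close> up to this error (\<open>mean_opt_scarce\<close>). The number of kept items
  concentrates well enough only if \<open>M \<le> T\<close>; for \<open>M \<ge> T\<close> no capacity ever
  binds and the comparison is exact (\<open>capacity_sure\<close>, \<open>mean_opt_abundant\<close>).

  Step \<open>s\<close> therefore earns at least \<open>(1 - 3\<eta>\<^sub>s - \<epsilon>\<^sup>2) g\<^sub>T(b) / T\<close> (\<open>stage_bound\<close>), where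
  \<open>\<eta>\<^sub>s = (\<epsilon>/64) sqrt (T/s)\<close> is admissible because \<open>l \<ge> 4\<close>. The losses add up to less than \<open>\<epsilon>\<close>
  since \<open>\<Sum>s\<le>T. sqrt (T/s)\<close> is at most \<open>2 T\<close> (\<open>competitive_ratio\<close>).
\<close>

section \<open>Inequalities and supports of measures\<close>

lemma exp_chord:
  fixes \<theta> u :: real
  assumes "0 \<le> u" "u \<le> 1"
  shows "exp (\<theta> * u) \<le> 1 + (exp \<theta> - 1) * u"
proof -
  have "convex_on UNIV (exp :: real \<Rightarrow> real)" by (rule exp_convex)
  from convex_onD[OF this, of u 0 \<theta>] assms show ?thesis
    by (simp add: algebra_simps)
qed

lemma sum_inverse_sqrt_le: "(\<Sum>s=1..n. 1 / sqrt (real s)) \<le> 2 * sqrt (real n)"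
proof (induction n)
  case (Suc n)
  define x y where "x = sqrt (real n)" and "y = sqrt (real (Suc n))"
  have xy: "0 \<le> x" "0 < y" "y * y = x * x + 1" by (auto simp: x_def y_def)
  \<comment> \<open>expanded with \<open>y\<^sup>2 = x\<^sup>2 + 1\<close>, this is the bound \<open>1 / y \<le> 2 (y - x)\<close> for the new summand\<close>
  have "0 \<le> (x - y)\<^sup>2" by simp
  then have "1 \<le> 2 * (y - x) * y" using xy by (simp add: power2_eq_square algebra_simps)
  then have "1 / y \<le> 2 * (y - x)" using xy by (simp add: divide_simps)
  then show ?case using Suc by (simp add: x_def y_def)
qed simp

text \<open>
  Negative summands are truncated to \<open>0\<close> on the right-hand side.
\<close>

lemma ennreal_sum_le: "ennreal (sum x I) \<le> (\<Sum>i\<in>I. ennreal (x i))"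
proof -
  have "ennreal (sum x I) \<le> ennreal (\<Sum>i\<in>I. max 0 (x i))" by (intro ennreal_leI sum_mono) simp
  also have "\<dots> = (\<Sum>i\<in>I. ennreal (max 0 (x i)))" by (intro sum_ennreal[symmetric]) simp
  finally show ?thesis by (simp add: ennreal_max_0)
qed

text \<open>
  The complement of the support is the union of the null sets in a countable basis.
\<close>

lemma AE_measure_support:
  fixes M :: "'a::second_countable_topology measure"
  assumes "sets M = sets borel"
  shows "AE x in M. x \<in> measure_support M"
proof -
  obtain B :: "'a set set" where B: "countable B" "topological_basis B"
    using ex_countable_basis by blast
  let ?N = "\<Union>U\<in>{U\<in>B. emeasure M U = 0}. U"
  have "?N \<in> null_sets M"
    using B assms by (intro null_sets_UN' countable_Collect) (auto simp: null_sets_def topological_basis_open)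
  then show ?thesis
  proof (rule AE_I')
    show "{x\<in>space M. x \<notin> measure_support M} \<subseteq> ?N"
    proof
      fix x assume "x \<in> {x\<in>space M. x \<notin> measure_support M}"
      then obtain U where U: "open U" "x \<in> U" "emeasure M U = 0"
        unfolding measure_support_def by (auto simp: not_less)
      then obtain V where V: "V \<in> B" "x \<in> V" "V \<subseteq> U"
        using topological_basisE[OF B(2)] by metis
      have "emeasure M V \<le> emeasure M U"
        using V U assms by (intro emeasure_mono) auto
      then show "x \<in> ?N" using U V by auto
    qed
  qed
qed

section \<open>Bernoulli sampling of a finite set\<close>

text \<open>
  The probability that \<open>N\<close> is the outcome when every element of \<open>I\<close> is kept independently with
  probability \<open>p\<close>.
\<close>

definition sample_weight :: "real \<Rightarrow> 'a set \<Rightarrow> 'a set \<Rightarrow> real" where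
  "sample_weight p I N = (\<Prod>i\<in>N. p) * (\<Prod>i\<in>I - N. 1 - p)"

lemma sample_weight_nonneg: "0 \<le> p \<Longrightarrow> p \<le> 1 \<Longrightarrow> 0 \<le> sample_weight p I N"
  unfolding sample_weight_def by (auto intro!: mult_nonneg_nonneg prod_nonneg)

lemma sum_sample_weight:
  assumes "finite I"
  shows "(\<Sum>N\<in>Pow I. sample_weight p I N) = 1"
  using prod_add[OF assms, of "\<lambda>_. p" "\<lambda>_. 1 - p"] by (simp add: sample_weight_def)

text \<open>
  Expanding \<open>\<Prod>j. p g\<^sub>j + (1 - p)\<close> enumerates all subsets of \<open>I\<close>; replacing the summand
  \<open>1 - p\<close> by \<open>0\<close> at \<open>j = i\<close> leaves those that contain \<open>i\<close>. This is the independence of the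
  sampled elements, and with \<open>g\<^sub>j = exp (\<eta> v\<^sub>j)\<close> it factorises an exponential moment.
\<close>

lemma sum_sample_weight_containing:
  assumes "finite I" "i \<in> I"
  shows "(\<Sum>N\<in>{N\<in>Pow I. i \<in> N}. sample_weight p I N * (\<Prod>j\<in>N. g j))
           = p * g i * (\<Prod>j\<in>I - {i}. p * g j + (1 - p))"
proof -
  \<comment> \<open>sets without \<open>i\<close> get weight \<open>0\<close>\<close>
  let ?q = "\<lambda>j. if j = i then 0 else 1 - p"
  have "(\<Sum>N\<in>{N\<in>Pow I. i \<in> N}. sample_weight p I N * (\<Prod>j\<in>N. g j))
      = (\<Sum>N\<in>Pow I. (\<Prod>j\<in>N. p * g j) * (\<Prod>j\<in>I - N. ?q j))"
  proof (rule sum.mono_neutral_cong_left)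
    show "\<forall>N\<in>Pow I - {N \<in> Pow I. i \<in> N}. (\<Prod>j\<in>N. p * g j) * (\<Prod>j\<in>I - N. ?q j) = 0"
      using assms by (auto intro!: prod_zero)
    show "sample_weight p I N * (\<Prod>j\<in>N. g j) = (\<Prod>j\<in>N. p * g j) * (\<Prod>j\<in>I - N. ?q j)"
      if "N \<in> {N \<in> Pow I. i \<in> N}" for N
    proof -
      have "(\<Prod>j\<in>I - N. ?q j) = (\<Prod>j\<in>I - N. 1 - p)"
        using that by (intro prod.cong) auto
      then show ?thesis by (simp add: sample_weight_def prod.distrib)
    qed
  qed (use assms in auto)
  also have "\<dots> = (\<Prod>j\<in>I. p * g j + ?q j)"
    using prod_add[OF assms(1), of "\<lambda>j. p * g j" ?q] by simp
  also have "\<dots> = p * g i * (\<Prod>j\<in>I - {i}. p * g j + (1 - p))"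
    using assms by (subst prod.remove[of _ i]) (auto intro!: prod.cong)
  finally show ?thesis .
qed

text \<open>
  Chernoff's bound for the sampled load, conditionally on \<open>i\<close> being sampled; the factor \<open>p\<close>
  is the probability of this condition. The expected load \<open>(1 - 3\<eta>) \<mu>\<close> lies by \<open>2\<eta>\<mu>\<close> below
  the threshold. The exponential moment with parameter \<open>\<eta>\<close> costs \<open>\<eta>\<^sup>2\<mu>\<close> of the resulting
  exponent \<open>2\<eta>\<^sup>2\<mu>\<close>, and the load of \<open>i\<close> itself, at most \<open>1\<close>, costs at most \<open>\<eta>\<close>.
\<close>

lemma sample_tail:
  fixes v :: "'a \<Rightarrow> real"
  assumes I: "finite I" "i \<in> I" and p: "0 \<le> p" "p \<le> 1"
    and v: "\<And>j. j \<in> I \<Longrightarrow> 0 \<le> v j" "\<And>j. j \<in> I \<Longrightarrow> v j \<le> 1"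
    and load: "p * sum v I \<le> (1 - 3 * \<eta>) * \<mu>" "(1 - \<eta>) * \<mu> \<le> \<beta>"
    and \<eta>: "0 < \<eta>" "\<eta> \<le> 1 / 3" "16 * L \<le> \<eta>\<^sup>2 * \<mu>" "1 \<le> L"
  shows "(\<Sum>N\<in>{N\<in>Pow I. i \<in> N \<and> \<beta> < sum v N}. sample_weight p I N) \<le> p * exp (- 2 * L)"
proof -
  have "(\<Sum>N\<in>{N\<in>Pow I. i \<in> N \<and> \<beta> < sum v N}. sample_weight p I N)
     \<le> (\<Sum>N\<in>{N\<in>Pow I. i \<in> N \<and> \<beta> < sum v N}. sample_weight p I N * exp (\<eta> * (sum v N - \<beta>)))"
  proof (rule sum_mono)
    fix N assume "N \<in> {N\<in>Pow I. i \<in> N \<and> \<beta> < sum v N}"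
    then have "1 \<le> exp (\<eta> * (sum v N - \<beta>))" using \<eta> by simp
    from mult_left_mono[OF this sample_weight_nonneg[OF p]]
    show "sample_weight p I N \<le> sample_weight p I N * exp (\<eta> * (sum v N - \<beta>))" by simp
  qed
  also have "\<dots> \<le> (\<Sum>N\<in>{N\<in>Pow I. i \<in> N}. sample_weight p I N * exp (\<eta> * (sum v N - \<beta>)))"
    using I p by (intro sum_mono2) (auto simp: sample_weight_nonneg)
  also have "\<dots> = exp (- \<eta> * \<beta>) *
      (\<Sum>N\<in>{N\<in>Pow I. i \<in> N}. sample_weight p I N * (\<Prod>j\<in>N. exp (\<eta> * v j)))"
    unfolding sum_distrib_left
  proof (rule sum.cong)
    fix N assume "N \<in> {N\<in>Pow I. i \<in> N}"
    then have "finite N" using I finite_subset by blast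
    then show "sample_weight p I N * exp (\<eta> * (sum v N - \<beta>)) =
      exp (- \<eta> * \<beta>) * (sample_weight p I N * (\<Prod>j\<in>N. exp (\<eta> * v j)))"
      by (simp add: exp_sum[symmetric] sum_distrib_left exp_add[symmetric] algebra_simps)
  qed simp
  also have "\<dots> = exp (- \<eta> * \<beta>) * (p * exp (\<eta> * v i) * (\<Prod>j\<in>I - {i}. p * exp (\<eta> * v j) + (1 - p)))"
    by (simp only: sum_sample_weight_containing[OF I])
  also have "\<dots> \<le> exp (- \<eta> * \<beta>) * (p * exp \<eta> * exp (p * (\<eta> + \<eta>\<^sup>2) * sum v I))"
  proof (intro mult_left_mono mult_mono)
    have "p * exp (\<eta> * v j) + (1 - p) \<le> exp (p * (\<eta> + \<eta>\<^sup>2) * v j)" if j: "j \<in> I" for j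
    proof -
      have "exp (\<eta> * v j) \<le> 1 + (exp \<eta> - 1) * v j" by (rule exp_chord) (use v j in auto)
      also have "\<dots> \<le> 1 + (\<eta> + \<eta>\<^sup>2) * v j"
        using exp_bound[of \<eta>] \<eta> v j by (intro add_left_mono mult_right_mono) auto
      finally have "p * exp (\<eta> * v j) \<le> p * (1 + (\<eta> + \<eta>\<^sup>2) * v j)" using p(1) by (rule mult_left_mono)
      then have "p * exp (\<eta> * v j) + (1 - p) \<le> 1 + p * (\<eta> + \<eta>\<^sup>2) * v j" by (simp add: algebra_simps)
      also have "\<dots> \<le> exp (p * (\<eta> + \<eta>\<^sup>2) * v j)" by (rule exp_ge_add_one_self)
      finally show ?thesis .
    qed
    then have "(\<Prod>j\<in>I - {i}. p * exp (\<eta> * v j) + (1 - p)) \<le> (\<Prod>j\<in>I - {i}. exp (p * (\<eta> + \<eta>\<^sup>2) * v j))"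
      using p by (intro prod_mono) (auto intro!: add_nonneg_nonneg)
    also have "\<dots> = exp (p * (\<eta> + \<eta>\<^sup>2) * sum v (I - {i}))"
      using I by (simp add: exp_sum sum_distrib_left)
    also have "\<dots> \<le> exp (p * (\<eta> + \<eta>\<^sup>2) * sum v I)"
      using I p \<eta> v by (auto intro!: mult_left_mono sum_mono2 mult_nonneg_nonneg)
    finally show "(\<Prod>j\<in>I - {i}. p * exp (\<eta> * v j) + (1 - p)) \<le> exp (p * (\<eta> + \<eta>\<^sup>2) * sum v I)" .
    show "exp (\<eta> * v i) \<le> exp \<eta>" using v[OF I(2)] \<eta> by (simp add: mult_left_le)
  qed (use p in \<open>auto intro!: prod_nonneg add_nonneg_nonneg\<close>)
  also have "\<dots> = p * exp (p * (\<eta> + \<eta>\<^sup>2) * sum v I - \<eta> * (\<beta> - 1))"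
    by (simp add: exp_add[symmetric] algebra_simps exp_diff exp_minus field_simps)
  also have "\<dots> \<le> p * exp (- 2 * L)"
  proof (intro mult_left_mono p, unfold exp_le_cancel_iff)
    have \<mu>: "1 \<le> \<eta> * \<mu>"
    proof -
      have "16 \<le> \<eta> * (\<eta> * \<mu>)" using \<eta> by (simp add: power2_eq_square)
      moreover have "\<eta> * (\<eta> * \<mu>) \<le> 1 * (\<eta> * \<mu>)" if "0 \<le> \<eta> * \<mu>" using \<eta> that by (intro mult_right_mono) auto
      ultimately show ?thesis using \<eta>(1) by (smt (verit) mult_pos_neg)
    qed
    have "p * (\<eta> + \<eta>\<^sup>2) * sum v I \<le> (\<eta> + \<eta>\<^sup>2) * ((1 - 3 * \<eta>) * \<mu>)"
      using mult_left_mono[OF load(1), of "\<eta> + \<eta>\<^sup>2"] \<eta> by (simp add: algebra_simps)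
    also have "\<dots> = \<eta> * \<mu> - 2 * (\<eta>\<^sup>2 * \<mu>) - 3 * (\<eta>\<^sup>2 * (\<eta> * \<mu>))"
      by (simp add: algebra_simps power2_eq_square)
    finally have 1: "p * (\<eta> + \<eta>\<^sup>2) * sum v I \<le> \<dots>" .
    have 2: "\<eta> * \<mu> - \<eta>\<^sup>2 * \<mu> \<le> \<eta> * \<beta>"
      using mult_left_mono[OF load(2), of \<eta>] \<eta> by (simp add: algebra_simps power2_eq_square)
    have 3: "0 \<le> \<eta>\<^sup>2 * (\<eta> * \<mu>)" using \<mu> by (intro mult_nonneg_nonneg[OF zero_le_power2]) linarith
    have "\<eta> * (\<beta> - 1) = \<eta> * \<beta> - \<eta>" by (simp add: algebra_simps)
    then show "p * (\<eta> + \<eta>\<^sup>2) * sum v I - \<eta> * (\<beta> - 1) \<le> - 2 * L"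
      using 1 2 3 \<eta> by linarith
  qed
  finally show ?thesis .
qed

text \<open>
  The event that the sample violates a bound is correlated with its value. Splitting the
  value into the contributions of single elements \<open>i\<close> reduces this to the probability of a
  violation when \<open>i\<close> is sampled, to which the union bound over \<open>\<kappa>\<close> applies.
\<close>

lemma sample_expectation:
  fixes w :: "'a \<Rightarrow> real" and v :: "'k::finite \<Rightarrow> 'a \<Rightarrow> real"
  assumes I: "finite I" and p: "0 \<le> p" "p \<le> 1"
    and w: "\<And>i. i \<in> I \<Longrightarrow> 0 \<le> w i"
    and tail: "\<And>\<kappa> i. i \<in> I \<Longrightarrow>
      (\<Sum>N\<in>{N\<in>Pow I. i \<in> N \<and> \<beta> \<kappa> < sum (v \<kappa>) N}. sample_weight p I N) \<le> p * \<delta>"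
  shows "p * (1 - real CARD('k) * \<delta>) * sum w I
     \<le> (\<Sum>N\<in>{N\<in>Pow I. \<forall>\<kappa>. sum (v \<kappa>) N \<le> \<beta> \<kappa>}. sample_weight p I N * sum w N)"
proof -
  let ?W = "sample_weight p I"
  let ?G = "{N\<in>Pow I. \<forall>\<kappa>. sum (v \<kappa>) N \<le> \<beta> \<kappa>}"
  have *: "p * (1 - real CARD('k) * \<delta>) \<le> (\<Sum>N\<in>{N\<in>?G. i \<in> N}. ?W N)" if i: "i \<in> I" for i
  proof -
    let ?B = "\<lambda>\<kappa>. {N\<in>Pow I. i \<in> N \<and> \<beta> \<kappa> < sum (v \<kappa>) N}"
    have "p = (\<Sum>N\<in>{N\<in>Pow I. i \<in> N}. ?W N)"
      using sum_sample_weight_containing[OF I i, of p "\<lambda>_. 1"] by simp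
    also have "\<dots> \<le> (\<Sum>N\<in>{N\<in>Pow I. i \<in> N}. (if \<forall>\<kappa>. sum (v \<kappa>) N \<le> \<beta> \<kappa> then ?W N else 0)
        + (\<Sum>\<kappa>\<in>UNIV. if \<beta> \<kappa> < sum (v \<kappa>) N then ?W N else 0))"
    proof (rule sum_mono)
      fix N
      have W: "0 \<le> ?W N" using p by (rule sample_weight_nonneg)
      show "?W N \<le> (if \<forall>\<kappa>. sum (v \<kappa>) N \<le> \<beta> \<kappa> then ?W N else 0)
        + (\<Sum>\<kappa>\<in>UNIV. if \<beta> \<kappa> < sum (v \<kappa>) N then ?W N else 0)"
      proof (cases "\<forall>\<kappa>. sum (v \<kappa>) N \<le> \<beta> \<kappa>")
        case False
        then obtain \<kappa> where "\<beta> \<kappa> < sum (v \<kappa>) N" by (auto simp: not_le)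
        with W show ?thesis
          using member_le_sum[of \<kappa> UNIV "\<lambda>\<kappa>. if \<beta> \<kappa> < sum (v \<kappa>) N then ?W N else 0"]
          by (auto simp: not_le[symmetric] split: if_splits)
      qed (use W in \<open>auto intro!: sum_nonneg\<close>)
    qed
    also have "\<dots> = (\<Sum>N\<in>{N\<in>?G. i \<in> N}. ?W N) + (\<Sum>\<kappa>\<in>UNIV. \<Sum>N\<in>?B \<kappa>. ?W N)"
      unfolding sum.distrib sum.swap[of _ UNIV] using I
      by (simp add: sum.inter_filter[symmetric] conj_ac)
    also have "\<dots> \<le> (\<Sum>N\<in>{N\<in>?G. i \<in> N}. ?W N) + (\<Sum>\<kappa>\<in>(UNIV::'k set). p * \<delta>)"
      by (intro add_left_mono sum_mono tail i)
    finally show ?thesis by (simp add: algebra_simps)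
  qed
  have "p * (1 - real CARD('k) * \<delta>) * sum w I = (\<Sum>i\<in>I. p * (1 - real CARD('k) * \<delta>) * w i)"
    by (simp add: sum_distrib_left)
  also have "\<dots> \<le> (\<Sum>i\<in>I. (\<Sum>N\<in>{N\<in>?G. i \<in> N}. ?W N) * w i)"
    by (intro sum_mono mult_right_mono * w)
  also have "\<dots> = (\<Sum>i\<in>I. \<Sum>N\<in>{N\<in>?G. i \<in> N}. ?W N * w i)" by (simp only: sum_distrib_right)
  also have "\<dots> = (\<Sum>N\<in>?G. \<Sum>i\<in>{i\<in>I. i \<in> N}. ?W N * w i)"
    using I by (intro sum.swap_restrict) auto
  also have "\<dots> = (\<Sum>N\<in>?G. ?W N * sum w N)"
    unfolding sum_distrib_left by (intro sum.cong refl) auto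
  finally show ?thesis .
qed

section \<open>Optimal assignments\<close>

definition usage :: "('m::finite, 'd::finite) item \<Rightarrow> real ^ 'm \<Rightarrow> real ^ 'd" where
  "usage \<xi> y = transpose (snd \<xi>) *v y"

abbreviation gain :: "('m::finite, 'd::finite) item \<Rightarrow> real ^ 'm \<Rightarrow> real" where
  "gain \<xi> y \<equiv> fst \<xi> \<bullet> y"

lemma usage_nth: "usage \<xi> y $ k = (\<Sum>j\<in>UNIV. snd \<xi> $ j $ k * y $ j)"
  by (simp add: usage_def matrix_vector_mult_def transpose_def)

lemma usage_zero [simp]: "usage \<xi> 0 = 0"
  by (simp add: usage_def)

lemma zero_in_Delta: "0 \<in> Delta"
  by (simp add: Delta_def)

lemma Delta_bounds:
  assumes "y \<in> Delta"
  shows "0 \<le> y $ j" "y $ j \<le> 1" "(\<Sum>j\<in>UNIV. y $ j) \<le> 1"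
proof -
  have "y $ j \<in> {0, 1}" using assms unfolding Delta_def by blast
  then show "0 \<le> y $ j" "y $ j \<le> 1" by auto
  show "(\<Sum>j\<in>UNIV. y $ j) \<le> 1" using assms by (simp add: Delta_def)
qed

lemma finite_Delta: "finite (Delta :: (real ^ 'm::finite) set)"
proof (rule finite_subset)
  show "Delta \<subseteq> vec_lambda ` (PiE (UNIV :: 'm set) (\<lambda>_. {0, 1 :: real}))"
  proof
    fix y :: "real ^ 'm" assume "y \<in> Delta"
    then have "vec_nth y \<in> PiE UNIV (\<lambda>_. {0, 1})" unfolding Delta_def by auto
    then have "vec_lambda (vec_nth y) \<in> vec_lambda ` (PiE (UNIV :: 'm set) (\<lambda>_. {0, 1 :: real}))"
      by (rule imageI)
    then show "y \<in> vec_lambda ` (PiE (UNIV :: 'm set) (\<lambda>_. {0, 1 :: real}))" by simp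
  qed
qed (intro finite_imageI finite_PiE; simp)

lemma finite_assignments: "finite (assignments s :: (real ^ 'm::finite) list set)"
  unfolding assignments_def using finite_lists_length_eq[OF finite_Delta, of s]
  by (simp add: conj_commute)

lemma norm_Delta_le: "y \<in> Delta \<Longrightarrow> norm y \<le> 1"
  by (rule order_trans[OF norm_le_l1_cart]) (simp add: Delta_bounds)

lemma usage_nonneg: "nonneg_item \<xi> \<Longrightarrow> y \<in> Delta \<Longrightarrow> 0 \<le> usage \<xi> y $ k"
  unfolding usage_nth nonneg_item_def by (intro sum_nonneg mult_nonneg_nonneg) (auto intro: Delta_bounds(1))

lemma usage_le:
  assumes "y \<in> Delta" "\<And>j. snd \<xi> $ j $ k \<le> a" "0 \<le> a"
  shows "usage \<xi> y $ k \<le> a"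
proof -
  have "usage \<xi> y $ k \<le> (\<Sum>j\<in>UNIV. a * y $ j)"
    unfolding usage_nth by (intro sum_mono mult_right_mono assms Delta_bounds)
  also have "\<dots> = a * (\<Sum>j\<in>UNIV. y $ j)" by (simp add: sum_distrib_left)
  also have "\<dots> \<le> a" using Delta_bounds(3)[OF assms(1)] assms(3) by (simp add: mult_left_le)
  finally show ?thesis .
qed

lemma consumption_nth:
  "consumption items xs $ k = (\<Sum>i<length items. usage (items ! i) (xs ! i) $ k)"
  by (simp add: consumption_def usage_def)

lemma consumption_snoc:
  "length xs = length items \<Longrightarrow> consumption (items @ [\<xi>]) (xs @ [y]) = consumption items xs + usage \<xi> y"
  by (simp add: consumption_def usage_def nth_append)

lemma reward_snoc:
  "length xs = length items \<Longrightarrow> reward (items @ [\<xi>]) (xs @ [y]) = reward items xs + gain \<xi> y"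
  by (simp add: reward_def nth_append)

lemma nth_assignment: "xs \<in> assignments s \<Longrightarrow> i < s \<Longrightarrow> xs ! i \<in> Delta"
  by (auto simp: assignments_def)

lemma feasible_mono: "(\<And>k. c $ k \<le> c' $ k) \<Longrightarrow> feasible items c \<subseteq> feasible items c'"
  unfolding feasible_def by (auto intro: order_trans)

lemma valid_instanceI:
  assumes "\<And>\<xi>. \<xi> \<in> set items \<Longrightarrow> nonneg_item \<xi>" "\<And>k. 0 \<le> c $ k"
  shows "valid_instance items c"
proof -
  have "replicate (length items) 0 \<in> feasible items c"
    unfolding feasible_def assignments_def
    using assms(2) by (auto simp: consumption_nth zero_in_Delta)
  then show ?thesis using assms(1) unfolding valid_instance_def by blast
qed

lemma solver_assignment:
  "exact_solver S \<Longrightarrow> ys \<in> set_pmf (S items c) \<Longrightarrow> ys \<in> assignments (length items)"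
  unfolding exact_solver_def by blast

lemma solver_optimal:
  assumes "exact_solver S" "valid_instance items c" "ys \<in> set_pmf (S items c)"
  shows "ys \<in> feasible items c" "zs \<in> feasible items c \<Longrightarrow> reward items zs \<le> reward items ys"
proof -
  have "is_arg_max (reward items) (\<lambda>ys. ys \<in> feasible items c) ys"
    using assms unfolding exact_solver_def by blast
  then show "ys \<in> feasible items c" "zs \<in> feasible items c \<Longrightarrow> reward items zs \<le> reward items ys"
    unfolding is_arg_max_def by (auto simp: not_less)
qed

lemma opt_value_eq_solver_reward:
  assumes "exact_solver S" "valid_instance items c" "ys \<in> set_pmf (S items c)"
  shows "opt_value items c = reward items ys"
  unfolding opt_value_def
proof (rule Max_eqI)
  show "finite (reward items ` feasible items c)"
    unfolding feasible_def by (intro finite_imageI finite_subset[OF _ finite_assignments]) auto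
qed (use solver_optimal[OF assms] in auto)

lemma solver_gain_nonneg:
  assumes S: "exact_solver S" and items: "\<And>\<xi>. \<xi> \<in> set items \<Longrightarrow> nonneg_item \<xi>"
    and c: "\<And>k. 0 \<le> c $ k" and ys: "ys \<in> set_pmf (S items c)" and i: "i < length items"
  shows "0 \<le> gain (items ! i) (ys ! i)"
proof -
  have v: "valid_instance items c" by (rule valid_instanceI) (use items c in auto)
  \<comment> \<open>dropping item \<open>i\<close> keeps the solution feasible, so it cannot increase the reward\<close>
  let ?zs = "ys[i := 0]"
  have ysf: "ys \<in> feasible items c" by (rule solver_optimal[OF S v ys])
  then have ysa: "ys \<in> assignments (length items)" by (simp add: feasible_def)
  have len: "length ys = length items" using ysa by (simp add: assignments_def)
  have less: "consumption items ?zs $ k \<le> consumption items ys $ k" for k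
    unfolding consumption_nth
  proof (rule sum_mono)
    fix l assume "l \<in> {..<length items}"
    then have "0 \<le> usage (items ! l) (ys ! l) $ k"
      using items[of "items ! l"] nth_assignment[OF ysa, of l] by (intro usage_nonneg) auto
    then show "usage (items ! l) (?zs ! l) $ k \<le> usage (items ! l) (ys ! l) $ k"
      using len \<open>l \<in> _\<close> by (cases "l = i") auto
  qed
  have "set ?zs \<subseteq> Delta"
    using ysa set_update_subset_insert[of ys i 0] zero_in_Delta unfolding assignments_def by blast
  then have "?zs \<in> feasible items c"
    using ysf len less unfolding feasible_def assignments_def by (auto intro: order_trans[OF less])
  then have "reward items ?zs \<le> reward items ys" by (rule solver_optimal(2)[OF S v ys])
  moreover have "reward items ys - reward items ?zs = gain (items ! i) (ys ! i)"
  proof -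
    have "reward items ys - reward items ?zs =
        (\<Sum>l<length items. if l = i then gain (items ! i) (ys ! i) else 0)"
      unfolding reward_def sum_subtractf[symmetric]
      using len i by (intro sum.cong) (auto simp: nth_list_update)
    also have "\<dots> = gain (items ! i) (ys ! i)" using i by simp
    finally show ?thesis .
  qed
  ultimately show ?thesis by simp
qed

text \<open>
  Decisions made for a larger pool of items can be reused on a sub-pool, here the image of \<open>e\<close>: keep
  those for the items in \<open>N\<close> and reject the rest.
\<close>

lemma solver_beats_restriction:
  assumes S: "exact_solver S" and f: "\<forall>i<s. nonneg_item (f (e i))" and c: "\<And>k. 0 \<le> c $ k"
    and e: "inj_on e {..<s}" and N: "N \<subseteq> e ` {..<s}"
    and x: "\<And>i. i \<in> N \<Longrightarrow> x i \<in> Delta" and fits: "\<And>k. (\<Sum>i\<in>N. usage (f i) (x i) $ k) \<le> c $ k"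
    and ys: "ys \<in> set_pmf (S (map (\<lambda>i. f (e i)) [0..<s]) c)"
  shows "(\<Sum>i\<in>N. gain (f i) (x i)) \<le> reward (map (\<lambda>i. f (e i)) [0..<s]) ys"
proof -
  let ?items = "map (\<lambda>i. f (e i)) [0..<s]"
  let ?zs = "map (\<lambda>i. if e i \<in> N then x (e i) else 0) [0..<s]"
  have v: "valid_instance ?items c" by (rule valid_instanceI) (use f c in auto)
  have reindex: "(\<Sum>i<s. if e i \<in> N then g (e i) else 0) = sum g N" for g :: "_ \<Rightarrow> real"
  proof -
    have "(\<Sum>i<s. if e i \<in> N then g (e i) else 0) = (\<Sum>i\<in>e ` {..<s}. if i \<in> N then g i else 0)"
      using e by (simp add: sum.reindex)
    also have "\<dots> = sum g N" using N by (simp add: sum.If_cases Int_absorb1)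
    finally show ?thesis .
  qed
  have "consumption ?items ?zs $ k = (\<Sum>i<s. if e i \<in> N then usage (f (e i)) (x (e i)) $ k else 0)" for k
    unfolding consumption_nth by (auto intro!: sum.cong)
  then have "consumption ?items ?zs $ k \<le> c $ k" for k
    using fits[of k] reindex[of "\<lambda>i. usage (f i) (x i) $ k"] by simp
  then have "?zs \<in> feasible ?items c"
    using x zero_in_Delta by (auto simp: feasible_def assignments_def)
  then have "reward ?items ?zs \<le> reward ?items ys" by (rule solver_optimal(2)[OF S v ys])
  moreover have "reward ?items ?zs = (\<Sum>i<s. if e i \<in> N then gain (f (e i)) (x (e i)) else 0)"
    unfolding reward_def by (auto intro!: sum.cong)
  ultimately show ?thesis using reindex[of "\<lambda>i. gain (f i) (x i)"] by simp
qed

section \<open>The decisions of the algorithm for fixed items\<close>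

lemma length_arrivals [simp]: "length (arrivals n \<omega>) = n"
  by (simp add: arrivals_def)

lemma arrivals_Suc: "arrivals (Suc n) \<omega> = arrivals n \<omega> @ [\<omega> (Suc n, Suc n)]"
  by (simp add: arrivals_def)

lemma arrivals_nth: "i < n \<Longrightarrow> arrivals n \<omega> ! i = \<omega> (Suc i, Suc i)"
  by (simp add: arrivals_def del: upt_Suc)

text \<open>
  The instance that is solved at time \<open>Suc n\<close>, numbered from \<open>0\<close> in the order in which the solver
  receives it; item \<open>0\<close> is the arriving one.
\<close>

definition row_item :: "nat \<Rightarrow> (nat \<times> nat \<Rightarrow> 'i) \<Rightarrow> nat \<Rightarrow> 'i" where
  "row_item n \<omega> i = \<omega> (Suc n, Suc n + i)"

lemma row_eq: "map (\<lambda>\<tau>. \<omega> (Suc n, \<tau>)) [Suc n..<Suc T] = map (row_item n \<omega>) [0..<T - n]"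
  by (rule nth_equalityI) (auto simp: row_item_def simp del: upt_Suc)

text \<open>
  The remaining capacity and the reward collected so far: the past influences future decisions
  only through the first component.
\<close>

definition state :: "real ^ 'd \<Rightarrow> nat \<Rightarrow> (nat \<times> nat \<Rightarrow> ('m::finite, 'd::finite) item) \<Rightarrow> (real ^ 'm) list
    \<Rightarrow> (real ^ 'd) \<times> real" where
  "state b n \<omega> xs = (b - consumption (arrivals n \<omega>) xs, reward (arrivals n \<omega>) xs)"

lemma state_snoc:
  assumes "length xs = n"
  shows "state b (Suc n) \<omega> (xs @ [y]) =
    (fst (state b n \<omega> xs) - usage (row_item n \<omega> 0) y, snd (state b n \<omega> xs) + gain (row_item n \<omega> 0) y)"
  using assms by (simp add: state_def arrivals_Suc consumption_snoc reward_snoc row_item_def)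

lemma oso_Suc:
  "oso S b T \<omega> (Suc n) = bind_pmf (oso S b T \<omega> n) (\<lambda>xs.
     bind_pmf (S (map (row_item n \<omega>) [0..<T - n]) (fst (state b n \<omega> xs))) (\<lambda>ys.
       return_pmf (xs @ [hd ys])))"
  by (simp only: oso.simps row_eq state_def fst_conv)

lemma oso_support:
  assumes S: "exact_solver S" and "n \<le> T" "xs \<in> set_pmf (oso S b T \<omega> n)"
  shows "xs \<in> assignments n"
  using assms(2,3)
proof (induction n arbitrary: xs)
  case (Suc n)
  from Suc.prems obtain zs ys where zs: "zs \<in> set_pmf (oso S b T \<omega> n)"
    and ys: "ys \<in> set_pmf (S (map (row_item n \<omega>) [0..<T - n]) (fst (state b n \<omega> zs)))"
    and xs: "xs = zs @ [hd ys]"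
    unfolding oso_Suc by auto
  have "ys \<in> assignments (T - n)" using solver_assignment[OF S ys] by simp
  then have "hd ys \<in> Delta" using Suc.prems by (cases ys) (auto simp: assignments_def)
  then show ?case using Suc.IH[OF _ zs] Suc.prems xs by (auto simp: assignments_def)
qed (simp add: assignments_def)

text \<open>
  The whole sampled solution fits into the remaining capacity, so its first decision alone does;
  and an optimal solution contains no item of negative gain.
\<close>

lemma oso_state_nonneg:
  assumes S: "exact_solver S" and b: "\<And>k. 0 \<le> b $ k"
    and "n \<le> T" "\<And>t \<tau>. 1 \<le> t \<Longrightarrow> t \<le> n \<Longrightarrow> t \<le> \<tau> \<Longrightarrow> \<tau> \<le> T \<Longrightarrow> nonneg_item (\<omega> (t, \<tau>))"
    and "xs \<in> set_pmf (oso S b T \<omega> n)"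
  shows "(\<forall>k. 0 \<le> fst (state b n \<omega> xs) $ k) \<and> 0 \<le> snd (state b n \<omega> xs)"
  using assms(3-5)
proof (induction n arbitrary: xs)
  case 0
  then show ?case using b by (simp add: state_def consumption_def reward_def)
next
  case (Suc n)
  let ?items = "\<lambda>n. map (row_item n \<omega>) [0..<T - n]"
  from Suc.prems obtain zs ys where zs: "zs \<in> set_pmf (oso S b T \<omega> n)"
    and ys: "ys \<in> set_pmf (S (?items n) (fst (state b n \<omega> zs)))"
    and xs: "xs = zs @ [hd ys]"
    unfolding oso_Suc by auto
  have IH: "\<And>k. 0 \<le> fst (state b n \<omega> zs) $ k" "0 \<le> snd (state b n \<omega> zs)"
    using Suc.IH[OF _ _ zs] Suc.prems by auto
  have nn: "\<And>\<xi>. \<xi> \<in> set (?items n) \<Longrightarrow> nonneg_item \<xi>"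
    using Suc.prems by (auto simp: row_item_def)
  have v: "valid_instance (?items n) (fst (state b n \<omega> zs))"
    by (rule valid_instanceI) (use nn IH in auto)
  have T: "0 < T - n" using Suc.prems by simp
  have ysf: "ys \<in> feasible (?items n) (fst (state b n \<omega> zs))" by (rule solver_optimal(1)[OF S v ys])
  then have ysa: "ys \<in> assignments (T - n)" by (simp add: feasible_def)
  then have hd: "hd ys = ys ! 0" using T by (cases ys) (auto simp: assignments_def)
  have len: "length zs = n" using oso_support[OF S _ zs] Suc.prems by (simp add: assignments_def)
  have "usage (row_item n \<omega> 0) (ys ! 0) $ k \<le> fst (state b n \<omega> zs) $ k" for k
  proof -
    have "0 \<le> usage (row_item n \<omega> i) (ys ! i) $ k" if "i < T - n" for i
      using that by (intro usage_nonneg nn nth_assignment[OF ysa]) auto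
    then have "usage (row_item n \<omega> 0) (ys ! 0) $ k \<le> consumption (?items n) ys $ k"
      unfolding consumption_nth
      using member_le_sum[of 0 "{..<T - n}" "\<lambda>i. usage (?items n ! i) (ys ! i) $ k"] T
      by auto
    also have "\<dots> \<le> fst (state b n \<omega> zs) $ k" using ysf by (simp add: feasible_def)
    finally show ?thesis .
  qed
  moreover have "0 \<le> gain (row_item n \<omega> 0) (ys ! 0)"
    using solver_gain_nonneg[OF S nn IH(1) ys, of 0] T by simp
  ultimately show ?case
    unfolding xs state_snoc[OF len] hd using IH by simp
qed

lemma oso_cong:
  fixes \<omega> \<omega>' :: "nat \<times> nat \<Rightarrow> ('m::finite, 'd::finite) item"
  assumes S: "exact_solver S"
    and "n \<le> T" "\<And>t \<tau>. 1 \<le> t \<Longrightarrow> t \<le> n \<Longrightarrow> t \<le> \<tau> \<Longrightarrow> \<tau> \<le> T \<Longrightarrow> \<omega> (t, \<tau>) = \<omega>' (t, \<tau>)"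
  shows "oso S b T \<omega> n = oso S b T \<omega>' n" "arrivals n \<omega> = arrivals n \<omega>'"
proof -
  have arr: "arrivals m \<omega> = arrivals m \<omega>'" if "m \<le> n" for m
    using that assms(2,3) by (intro nth_equalityI) (auto simp: arrivals_nth)
  show "arrivals n \<omega> = arrivals n \<omega>'" by (rule arr) simp
  have "oso S b T \<omega> m = oso S b T \<omega>' m" if "m \<le> n" for m
    using that
  proof (induction m)
    case (Suc m)
    have row: "map (row_item m \<omega>) [0..<T - m] = map (row_item m \<omega>') [0..<T - m]"
      using Suc.prems assms(2,3) by (auto simp: row_item_def)
    have IH: "oso S b T \<omega> m = oso S b T \<omega>' m" and ar: "arrivals m \<omega> = arrivals m \<omega>'"
      using Suc arr[of m] by auto
    show ?case by (simp only: oso_Suc state_def row IH ar)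
  qed simp
  then show "oso S b T \<omega> n = oso S b T \<omega>' n" by simp
qed

section \<open>The state of the algorithm as a Markov chain\<close>

lemma borel_measurable_usage: "(\<lambda>\<xi>. usage \<xi> y) \<in> borel_measurable borel"
proof -
  have "continuous_on UNIV (\<lambda>\<xi> :: ('a, 'b) item. usage \<xi> y)"
    unfolding usage_def matrix_vector_mult_def transpose_def by (intro continuous_intros)
  then show ?thesis by (rule borel_measurable_continuous_onI)
qed

lemma borel_measurable_gain: "(\<lambda>\<xi>. gain \<xi> y) \<in> borel_measurable borel"
  by (intro borel_measurable_continuous_onI continuous_intros)

locale allocation = prob_space D
  for D :: "('m::finite, 'd::finite) item measure" +
  fixes S :: "('m, 'd) solver" and b :: "real ^ 'd" and T :: nat
  assumes sets_D [measurable_cong]: "sets D = sets borel"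
    and integrable_rewards: "integrable D fst"
    and AE_nonneg: "AE \<xi> in D. nonneg_item \<xi>"
    and capacity_nonneg: "\<And>k. 0 \<le> b $ k"
    and exact: "exact_solver S"
    and equivariant: "equivariant_solver S"
    and measurable_S: "measurable_solver S"
begin

abbreviation draws :: "nat \<Rightarrow> (nat \<Rightarrow> ('m, 'd) item) measure" where
  "draws s \<equiv> \<Pi>\<^sub>M i\<in>{..<s}. D"

definition rows :: "nat \<Rightarrow> (nat \<times> nat) set" where
  "rows n = {(t, \<tau>). 1 \<le> t \<and> t \<le> n \<and> t \<le> \<tau> \<and> \<tau> \<le> T}"

lemma finite_rows: "finite (rows n)"
  by (rule finite_subset[of _ "{..n} \<times> {..T}"]) (auto simp: rows_def)

lemma item_space_eq: "item_space D T = (\<Pi>\<^sub>M i\<in>rows T. D)"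
  unfolding item_space_def rows_def by (intro PiM_cong) auto

text \<open>
  The expectation of \<open>F\<close> over \<open>s\<close> i.i.d. items and over the solver's decisions for them with
  capacity \<open>c\<close>. Expectations are nonnegative extended reals throughout, which makes
  integrability a question for the very end.
\<close>

definition solved :: "nat \<Rightarrow> real ^ 'd \<Rightarrow> ((nat \<Rightarrow> ('m, 'd) item) \<Rightarrow> (real ^ 'm) list \<Rightarrow> ennreal) \<Rightarrow> ennreal" where
  "solved s c F = (\<integral>\<^sup>+f. \<integral>\<^sup>+ys. F f ys \<partial>measure_pmf (S (map f [0..<s]) c) \<partial>draws s)"

text \<open>
  The expectation of a function of the state after \<open>n\<close> decisions. Only the items drawn up to time
  \<open>n\<close> are integrated over.
\<close>

definition staged :: "nat \<Rightarrow> ((real ^ 'd) \<times> real \<Rightarrow> ennreal) \<Rightarrow> ennreal" where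
  "staged n h = (\<integral>\<^sup>+\<omega>. \<integral>\<^sup>+xs. h (state b n \<omega> xs) \<partial>measure_pmf (oso S b T \<omega> n) \<partial>(\<Pi>\<^sub>M i\<in>rows n. D))"

lemma measurable_usage [measurable]: "(\<lambda>\<xi>. usage \<xi> y) \<in> borel_measurable D"
  using borel_measurable_usage by (simp add: measurable_cong_sets[OF sets_D refl])

lemma measurable_gain [measurable]: "(\<lambda>\<xi>. gain \<xi> y) \<in> borel_measurable D"
  using borel_measurable_gain by (simp add: measurable_cong_sets[OF sets_D refl])

lemma measurable_solver_pmf:
  assumes g: "g \<in> measurable X (draws s)" and c: "c \<in> borel_measurable X"
  shows "(\<lambda>x. pmf (S (map (g x) [0..<s]) (c x)) ys) \<in> borel_measurable X"
proof -
  have "sets (draws s) = sets (\<Pi>\<^sub>M i\<in>{..<s}. (borel :: ('m, 'd) item measure))"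
    by (intro sets_PiM_cong refl sets_D)
  then have g': "g \<in> measurable X (\<Pi>\<^sub>M i\<in>{..<s}. borel)"
    using g measurable_cong_sets[OF refl] by blast
  have "(\<lambda>(f, c). pmf (S (map f [0..<s]) c) ys)
      \<in> borel_measurable ((\<Pi>\<^sub>M i\<in>{..<s}. borel) \<Otimes>\<^sub>M borel)"
    using measurable_S unfolding measurable_solver_def by blast
  from measurable_compose[OF measurable_Pair[OF g' c] this] show ?thesis by simp
qed

text \<open>
  Outputs range over a finite set, so integrals over them are finite sums; all measurability
  statements about the algorithm come down to that of the output probabilities.
\<close>

lemma nn_integral_solver:
  "(\<integral>\<^sup>+ys. F ys \<partial>measure_pmf (S (map f [0..<s]) c))
     = (\<Sum>ys\<in>assignments s. F ys * ennreal (pmf (S (map f [0..<s]) c) ys))"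
  using solver_assignment[OF exact, of _ "map f [0..<s]" c]
  by (intro nn_integral_measure_pmf_support finite_assignments) auto

lemma nn_integral_oso:
  assumes "n \<le> T"
  shows "(\<integral>\<^sup>+xs. F xs \<partial>measure_pmf (oso S b T \<omega> n)) = (\<Sum>xs\<in>assignments n. F xs * ennreal (pmf (oso S b T \<omega> n) xs))"
  using oso_support[OF exact assms] by (intro nn_integral_measure_pmf_support finite_assignments) auto

lemma measurable_nn_integral_solver:
  assumes g: "g \<in> measurable X (draws s)" and c: "c \<in> borel_measurable X"
    and F: "\<And>ys. ys \<in> assignments s \<Longrightarrow> (\<lambda>x. F x ys) \<in> borel_measurable X"
  shows "(\<lambda>x. \<integral>\<^sup>+ys. F x ys \<partial>measure_pmf (S (map (g x) [0..<s]) (c x))) \<in> borel_measurable X"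
  unfolding nn_integral_solver
  using F measurable_solver_pmf[OF g c]
  by (intro borel_measurable_sum borel_measurable_times_ennreal measurable_compose[OF _ measurable_ennreal]) auto

lemma measurable_state:
  assumes "n \<le> T" "rows n \<subseteq> J"
  shows "(\<lambda>\<omega>. state b n \<omega> xs) \<in> borel_measurable (\<Pi>\<^sub>M i\<in>J. D)"
proof -
  have J: "(Suc i, Suc i) \<in> J" if "i < n" for i
    using that assms by (auto simp: rows_def)
  then have J': "(\<lambda>\<omega>. \<omega> (Suc i, Suc i)) \<in> measurable (\<Pi>\<^sub>M i\<in>J. D) D" if "i < n" for i
    using that by (intro measurable_component_singleton)
  show ?thesis
    unfolding state_def consumption_def reward_def usage_def[symmetric] length_arrivals
    by (intro borel_measurable_Pair borel_measurable_diff borel_measurable_const borel_measurable_sum)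
      (auto simp: arrivals_nth intro!: measurable_compose[OF J' measurable_usage] measurable_compose[OF J' measurable_gain])
qed

lemma measurable_row:
  assumes "rows (Suc n) \<subseteq> J"
  shows "(\<lambda>\<omega>. restrict (row_item n \<omega>) {..<T - n}) \<in> measurable (\<Pi>\<^sub>M i\<in>J. D) (draws (T - n))"
  unfolding row_item_def
  by (intro measurable_restrict measurable_component_singleton) (use assms in \<open>auto simp: rows_def\<close>)

lemma map_restrict_upt: "map (restrict f {..<s}) [0..<s] = map f [0..<s]"
  by simp

lemma hd_assignment: "ys \<in> assignments s \<Longrightarrow> 0 < s \<Longrightarrow> hd ys = ys ! 0 \<and> ys ! 0 \<in> Delta"
  by (cases ys) (auto simp: assignments_def)

lemma measurable_nn_integral_oso:
  assumes "n \<le> T" "rows n \<subseteq> J"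
    and "\<And>xs. xs \<in> assignments n \<Longrightarrow> (\<lambda>\<omega>. F \<omega> xs) \<in> borel_measurable (\<Pi>\<^sub>M i\<in>J. D)"
  shows "(\<lambda>\<omega>. \<integral>\<^sup>+xs. F \<omega> xs \<partial>measure_pmf (oso S b T \<omega> n)) \<in> borel_measurable (\<Pi>\<^sub>M i\<in>J. D)"
  using assms
proof (induction n arbitrary: F)
  case 0
  then show ?case by (simp add: assignments_def)
next
  case (Suc n)
  have sub: "rows n \<subseteq> J" using Suc.prems(2) by (auto simp: rows_def)
  have "(\<lambda>\<omega>. \<integral>\<^sup>+ys. F \<omega> (xs @ [hd ys]) \<partial>measure_pmf
      (S (map (restrict (row_item n \<omega>) {..<T - n}) [0..<T - n]) (fst (state b n \<omega> xs))))
      \<in> borel_measurable (\<Pi>\<^sub>M i\<in>J. D)" if xs: "xs \<in> assignments n" for xs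
  proof (rule measurable_nn_integral_solver[OF measurable_row[OF Suc.prems(2)]])
    show "(\<lambda>\<omega>. fst (state b n \<omega> xs)) \<in> borel_measurable (\<Pi>\<^sub>M i\<in>J. D)"
      using measurable_state[OF _ sub, of xs] Suc.prems(1)
      by (intro measurable_compose[OF _ borel_measurable_continuous_onI[OF continuous_on_fst[OF continuous_on_id]]]) auto
    show "(\<lambda>\<omega>. F \<omega> (xs @ [hd ys])) \<in> borel_measurable (\<Pi>\<^sub>M i\<in>J. D)" if "ys \<in> assignments (T - n)" for ys
      using xs hd_assignment[OF that] Suc.prems(1) by (intro Suc.prems(3)) (auto simp: assignments_def)
  qed
  note step = this[unfolded map_restrict_upt]
  have "n \<le> T" using Suc.prems(1) by simp
  from Suc.IH[OF this sub step] show ?case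
    by (simp add: oso_Suc del: oso.simps)
qed

text \<open>
  The Markov property: given the present state, the next decision is made on items that were
  never used before.
\<close>

lemma staged_Suc:
  assumes n: "n < T" and h: "h \<in> borel_measurable borel"
  shows "staged (Suc n) h = staged n (\<lambda>(c, R).
    solved (T - n) c (\<lambda>f ys. h (c - usage (f 0) (hd ys), R + gain (f 0) (hd ys))))"
proof -
  interpret P: product_sigma_finite "\<lambda>_ :: nat \<times> nat. D" by standard
  \<comment> \<open>the items drawn at time \<open>Suc n\<close>, independent of the earlier rows\<close>
  define new where "new = {Suc n} \<times> {Suc n..T}"
  have rows: "rows (Suc n) = rows n \<union> new" and disj: "rows n \<inter> new = {}" and fin: "finite new"
    by (auto simp: rows_def new_def)
  let ?next = "\<lambda>c R ys f. h (c - usage (f 0) (hd ys), R + gain (f 0) (hd ys))"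
  let ?inner = "\<lambda>c R f. \<integral>\<^sup>+ys. ?next c R ys f \<partial>measure_pmf (S (map f [0..<T - n]) c)"
  have inner_measurable: "(\<lambda>y. ?inner c R (row_item n y)) \<in> borel_measurable (\<Pi>\<^sub>M i\<in>new. D)"
    and fresh: "(\<integral>\<^sup>+y. ?inner c R (row_item n y) \<partial>(\<Pi>\<^sub>M i\<in>new. D)) = (\<integral>\<^sup>+f. ?inner c R f \<partial>draws (T - n))" for c R
  proof -
    have D: "draws (T - n) = distr (\<Pi>\<^sub>M i\<in>new. D) (draws (T - n)) (\<lambda>y. restrict (row_item n y) {..<T - n})"
      unfolding row_item_def
      by (rule distr_PiM_reindex[symmetric]) (auto simp: inj_on_def new_def prob_space_axioms)
    have m: "(\<lambda>y. restrict (row_item n y) {..<T - n}) \<in> measurable (\<Pi>\<^sub>M i\<in>new. D) (draws (T - n))"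
      unfolding row_item_def
      by (intro measurable_restrict measurable_component_singleton) (auto simp: new_def)
    have c0: "(\<lambda>f. f 0) \<in> measurable (draws (T - n)) D"
      using n by (intro measurable_component_singleton) auto
    have im: "(\<lambda>f. ?inner c R f) \<in> borel_measurable (draws (T - n))"
    proof (rule measurable_nn_integral_solver)
      fix ys
      show "(\<lambda>f. ?next c R ys f) \<in> borel_measurable (draws (T - n))"
        by (intro measurable_compose[OF _ h] borel_measurable_Pair borel_measurable_diff borel_measurable_add
            borel_measurable_const measurable_compose[OF c0 measurable_usage] measurable_compose[OF c0 measurable_gain])
    qed auto
    have "(\<integral>\<^sup>+f. ?inner c R f \<partial>draws (T - n))
        = (\<integral>\<^sup>+y. ?inner c R (restrict (row_item n y) {..<T - n}) \<partial>(\<Pi>\<^sub>M i\<in>new. D))"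
      by (subst D, subst nn_integral_distr[OF m]) (use im in auto)
    also have "\<dots> = (\<integral>\<^sup>+y. ?inner c R (row_item n y) \<partial>(\<Pi>\<^sub>M i\<in>new. D))"
      unfolding map_restrict_upt using n by simp
    finally show "(\<integral>\<^sup>+y. ?inner c R (row_item n y) \<partial>(\<Pi>\<^sub>M i\<in>new. D)) = (\<integral>\<^sup>+f. ?inner c R f \<partial>draws (T - n))" by simp
    show "(\<lambda>y. ?inner c R (row_item n y)) \<in> borel_measurable (\<Pi>\<^sub>M i\<in>new. D)"
      using measurable_compose[OF m im] n unfolding map_restrict_upt by simp
  qed
  let ?M = "\<lambda>x y. merge (rows n) new (x, y)"
  have old: "oso S b T (?M x y) n = oso S b T x n" "state b n (?M x y) xs = state b n x xs" for x y xs
  proof -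
    have *: "?M x y (t, \<tau>) = x (t, \<tau>)" if "1 \<le> t" "t \<le> n" "t \<le> \<tau>" "\<tau> \<le> T" for t \<tau>
      using that by (simp add: merge_def rows_def)
    show "oso S b T (?M x y) n = oso S b T x n"
      by (rule oso_cong(1)[OF exact]) (use n * in auto)
    have "arrivals n (?M x y) = arrivals n x"
      by (rule oso_cong(2)[OF exact, of _ T]) (use n * in auto)
    then show "state b n (?M x y) xs = state b n x xs" by (simp add: state_def)
  qed
  have row: "row_item n (?M x y) i = row_item n y i" if "i < T - n" for x y i
    using that n disj by (auto simp: row_item_def merge_def new_def rows_def)
  have rowmap: "map (row_item n (?M x y)) [0..<T - n] = map (row_item n y) [0..<T - n]" for x y
    using row by (intro map_cong) auto
  have "staged (Suc n) h = (\<integral>\<^sup>+x. \<integral>\<^sup>+y. \<integral>\<^sup>+xs. h (state b (Suc n) (?M x y) xs)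
      \<partial>measure_pmf (oso S b T (?M x y) (Suc n)) \<partial>(\<Pi>\<^sub>M i\<in>new. D) \<partial>(\<Pi>\<^sub>M i\<in>rows n. D))"
    unfolding staged_def rows
    using n h by (intro P.product_nn_integral_fold disj finite_rows fin measurable_nn_integral_oso
        measurable_compose[OF measurable_state h]) (auto simp: rows)
  also have "\<dots> = (\<integral>\<^sup>+x. \<integral>\<^sup>+y. \<integral>\<^sup>+xs. ?inner (fst (state b n x xs)) (snd (state b n x xs)) (row_item n y)
      \<partial>measure_pmf (oso S b T x n) \<partial>(\<Pi>\<^sub>M i\<in>new. D) \<partial>(\<Pi>\<^sub>M i\<in>rows n. D))"
  proof (intro nn_integral_cong)
    fix x y
    have "(\<integral>\<^sup>+xs. h (state b (Suc n) (?M x y) xs) \<partial>measure_pmf (oso S b T (?M x y) (Suc n)))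
      = (\<integral>\<^sup>+xs. \<integral>\<^sup>+ys. h (state b (Suc n) (?M x y) (xs @ [hd ys]))
          \<partial>measure_pmf (S (map (row_item n y) [0..<T - n]) (fst (state b n x xs))) \<partial>measure_pmf (oso S b T x n))"
      by (simp add: oso_Suc old rowmap del: oso.simps)
    also have "\<dots> = (\<integral>\<^sup>+xs. ?inner (fst (state b n x xs)) (snd (state b n x xs)) (row_item n y)
        \<partial>measure_pmf (oso S b T x n))"
    proof (intro nn_integral_cong_AE, unfold AE_measure_pmf_iff, intro ballI nn_integral_cong)
      fix xs ys assume "xs \<in> set_pmf (oso S b T x n)"
      then have "length xs = n" using oso_support[OF exact, of n T xs b x] n by (simp add: assignments_def)
      then show "h (state b (Suc n) (?M x y) (xs @ [hd ys])) =
          ?next (fst (state b n x xs)) (snd (state b n x xs)) ys (row_item n y)"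
        using row[of 0 x y] n by (simp add: state_snoc old)
    qed
    finally show "(\<integral>\<^sup>+xs. h (state b (Suc n) (?M x y) xs) \<partial>measure_pmf (oso S b T (?M x y) (Suc n)))
      = (\<integral>\<^sup>+xs. ?inner (fst (state b n x xs)) (snd (state b n x xs)) (row_item n y)
          \<partial>measure_pmf (oso S b T x n))" .
  qed
  also have "\<dots> = (\<integral>\<^sup>+x. \<integral>\<^sup>+xs. \<integral>\<^sup>+y. ?inner (fst (state b n x xs)) (snd (state b n x xs)) (row_item n y)
      \<partial>(\<Pi>\<^sub>M i\<in>new. D) \<partial>measure_pmf (oso S b T x n) \<partial>(\<Pi>\<^sub>M i\<in>rows n. D))"
    using n by (simp add: nn_integral_oso nn_integral_sum nn_integral_multc inner_measurable borel_measurable_times_ennreal)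
  also have "\<dots> = staged n (\<lambda>(c, R).
    solved (T - n) c (\<lambda>f ys. h (c - usage (f 0) (hd ys), R + gain (f 0) (hd ys))))"
    unfolding fresh staged_def solved_def by (simp add: case_prod_unfold)
  finally show ?thesis .
qed

section \<open>Exchangeability of the items of an instance\<close>

lemma AE_PiM_all:
  assumes "finite J" "AE \<xi> in D. Q \<xi>"
  shows "AE \<omega> in (\<Pi>\<^sub>M i\<in>J. D). \<forall>i\<in>J. Q (\<omega> i)"
  using assms by (intro AE_finite_allI AE_PiM_component prob_space_axioms) auto

lemma measurable_draw: "i < s \<Longrightarrow> (\<lambda>f. f i) \<in> measurable (draws s) D"
  by (intro measurable_component_singleton) auto

lemma nn_integral_draws_reindex:
  assumes e: "inj_on e {..<s}" "e ` {..<s} \<subseteq> J" and F: "F \<in> borel_measurable (draws s)"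
  shows "(\<integral>\<^sup>+f. F f \<partial>draws s) = (\<integral>\<^sup>+f. F (restrict (\<lambda>i. f (e i)) {..<s}) \<partial>(\<Pi>\<^sub>M i\<in>J. D))"
proof -
  have m: "(\<lambda>f. restrict (\<lambda>i. f (e i)) {..<s}) \<in> measurable (\<Pi>\<^sub>M i\<in>J. D) (draws s)"
    by (intro measurable_restrict measurable_component_singleton) (use e in auto)
  have "draws s = distr (\<Pi>\<^sub>M i\<in>J. D) (draws s) (\<lambda>f. restrict (\<lambda>i. f (e i)) {..<s})"
    by (rule distr_PiM_reindex[symmetric]) (use e prob_space_axioms in auto)
  then have "(\<integral>\<^sup>+f. F f \<partial>draws s) = (\<integral>\<^sup>+f. F f \<partial>distr (\<Pi>\<^sub>M i\<in>J. D) (draws s) (\<lambda>f. restrict (\<lambda>i. f (e i)) {..<s}))"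
    by simp
  also have "\<dots> = (\<integral>\<^sup>+f. F (restrict (\<lambda>i. f (e i)) {..<s}) \<partial>(\<Pi>\<^sub>M i\<in>J. D))"
    by (rule nn_integral_distr[OF m]) (use F in simp)
  finally show ?thesis .
qed

lemma solved_mono:
  assumes "AE \<xi> in D. Q \<xi>"
    and "\<And>f ys. (\<forall>i<s. Q (f i)) \<Longrightarrow> ys \<in> set_pmf (S (map f [0..<s]) c) \<Longrightarrow> F f ys \<le> F' f ys"
  shows "solved s c F \<le> solved s c F'"
  unfolding solved_def
proof (rule nn_integral_mono_AE, use AE_PiM_all[OF finite_lessThan assms(1), of s] in eventually_elim)
  case (elim f)
  then show ?case
    using assms(2) by (intro nn_integral_mono_AE) (auto simp: AE_measure_pmf_iff)
qed

lemma solved_cong: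
  assumes "AE \<xi> in D. Q \<xi>"
    and "\<And>f ys. (\<forall>i<s. Q (f i)) \<Longrightarrow> ys \<in> set_pmf (S (map f [0..<s]) c) \<Longrightarrow> F f ys = F' f ys"
  shows "solved s c F = solved s c F'"
  using assms(2) by (intro antisym solved_mono[OF assms(1)]) auto

lemma measurable_solved_integrand:
  assumes "\<And>ys. ys \<in> assignments s \<Longrightarrow> (\<lambda>f. F f ys) \<in> borel_measurable (draws s)"
  shows "(\<lambda>f. \<integral>\<^sup>+ys. F f ys \<partial>measure_pmf (S (map f [0..<s]) c)) \<in> borel_measurable (draws s)"
  using measurable_nn_integral_solver[of "\<lambda>f. f" "draws s" s "\<lambda>_. c" F] assms by simp

lemma solved_const: "solved s c (\<lambda>_ _. a) = a"
proof -
  interpret P: prob_space "draws s" by (intro prob_space_PiM prob_space_axioms)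
  show ?thesis unfolding solved_def by (simp add: P.emeasure_space_1)
qed

lemma solved_add:
  assumes "\<And>ys. ys \<in> assignments s \<Longrightarrow> (\<lambda>f. F f ys) \<in> borel_measurable (draws s)"
    and "\<And>ys. ys \<in> assignments s \<Longrightarrow> (\<lambda>f. F' f ys) \<in> borel_measurable (draws s)"
  shows "solved s c (\<lambda>f ys. F f ys + F' f ys) = solved s c F + solved s c F'"
  unfolding solved_def using assms
  by (simp add: nn_integral_add measurable_solved_integrand)

lemma solved_sum:
  assumes "finite K" "\<And>i ys. i \<in> K \<Longrightarrow> ys \<in> assignments s \<Longrightarrow> (\<lambda>f. F i f ys) \<in> borel_measurable (draws s)"
  shows "solved s c (\<lambda>f ys. \<Sum>i\<in>K. F i f ys) = (\<Sum>i\<in>K. solved s c (F i))"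
  using assms
proof (induction K rule: finite_induct)
  case (insert i K)
  then have "solved s c (\<lambda>f ys. F i f ys + (\<Sum>i\<in>K. F i f ys)) = solved s c (F i) + solved s c (\<lambda>f ys. \<Sum>i\<in>K. F i f ys)"
    by (intro solved_add borel_measurable_sum) auto
  then show ?case using insert by simp
qed (simp add: solved_const)

lemma solved_cmult:
  assumes "\<And>ys. ys \<in> assignments s \<Longrightarrow> (\<lambda>f. F f ys) \<in> borel_measurable (draws s)"
  shows "solved s c (\<lambda>f ys. a * F f ys) = a * solved s c F"
  unfolding solved_def using assms
  by (simp add: nn_integral_cmult measurable_solved_integrand)

lemma solver_permuted:
  assumes "\<forall>i<s. nonneg_item (f i)" "\<And>k. 0 \<le> c $ k" "p permutes {..<s}"
  shows "S (map (\<lambda>i. f (p i)) [0..<s]) c = map_pmf (permute_list p) (S (map f [0..<s]) c)"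
proof -
  have "map (\<lambda>i. f (p i)) [0..<s] = permute_list p (map f [0..<s])"
    using permutes_in_image[OF assms(3)] by (intro nth_equalityI) (auto simp: permute_list_def)
  moreover have "valid_instance (map f [0..<s]) c"
    by (rule valid_instanceI) (use assms in auto)
  ultimately show ?thesis
    using equivariant assms(3) unfolding equivariant_solver_def by simp
qed

text \<open>
  Exchanging items \<open>0\<close> and \<open>i\<close> preserves their joint law, and by equivariance it exchanges the
  decisions for them.
\<close>

lemma solved_symmetric:
  assumes c: "\<And>k. 0 \<le> c $ k" and i: "i < s" and \<phi>: "\<And>y. (\<lambda>\<xi>. \<phi> \<xi> y) \<in> borel_measurable D"
  shows "solved s c (\<lambda>f ys. \<phi> (f 0) (ys ! 0)) = solved s c (\<lambda>f ys. \<phi> (f i) (ys ! i))"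
proof -
  define p where "p = Transposition.transpose 0 i"
  have p: "p permutes {..<s}" unfolding p_def using i by (intro permutes_swap_id) auto
  have p0: "p 0 = i" by (simp add: p_def)
  have m: "(\<lambda>f. \<phi> (f 0) (ys ! 0)) \<in> borel_measurable (draws s)" for ys
    using i by (intro measurable_compose[OF measurable_draw \<phi>]) auto
  have "solved s c (\<lambda>f ys. \<phi> (f 0) (ys ! 0)) = (\<integral>\<^sup>+f. \<integral>\<^sup>+ys. \<phi> (restrict (\<lambda>i. f (p i)) {..<s} 0) (ys ! 0)
      \<partial>measure_pmf (S (map (restrict (\<lambda>i. f (p i)) {..<s}) [0..<s]) c) \<partial>draws s)"
    unfolding solved_def
    by (rule nn_integral_draws_reindex)
      (use permutes_image[OF p] permutes_inj_on[OF p] m in \<open>auto intro: measurable_solved_integrand\<close>)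
  also have "\<dots> = solved s c (\<lambda>f ys. \<phi> (f i) (ys ! i))"
    unfolding solved_def map_restrict_upt
  proof (rule nn_integral_cong_AE, use AE_PiM_all[OF finite_lessThan AE_nonneg, of s] in eventually_elim)
    case (elim f)
    then have f: "\<forall>i<s. nonneg_item (f i)" by auto
    have pi: "permute_list p ys ! 0 = ys ! i" if "ys \<in> set_pmf (S (map f [0..<s]) c)" for ys
    proof -
      have "length ys = s" using solver_assignment[OF exact that] by (simp add: assignments_def)
      then show ?thesis using p i p0 by (subst permute_list_nth) auto
    qed
    have S: "S (map (\<lambda>i. f (p i)) [0..<s]) c = map_pmf (permute_list p) (S (map f [0..<s]) c)"
      by (rule solver_permuted[OF f c p])
    show ?case
      unfolding S nn_integral_map_pmf using i p0 pi
      by (intro nn_integral_cong_AE) (auto simp: AE_measure_pmf_iff)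
  qed
  finally show ?thesis .
qed

text \<open>
  The decision that the algorithm implements is the one for item \<open>0\<close> of a symmetric instance, so
  that it accounts on average for the fraction \<open>1/s\<close> of any total.
\<close>

lemma solved_first:
  assumes c: "\<And>k. 0 \<le> c $ k" and s: "0 < s" and \<phi>: "\<And>y. (\<lambda>\<xi>. \<phi> \<xi> y) \<in> borel_measurable D"
  shows "solved s c (\<lambda>f ys. \<phi> (f 0) (hd ys)) = solved s c (\<lambda>f ys. \<Sum>i<s. \<phi> (f i) (ys ! i)) / of_nat s"
proof -
  have "solved s c (\<lambda>f ys. \<Sum>i<s. \<phi> (f i) (ys ! i)) = (\<Sum>i<s. solved s c (\<lambda>f ys. \<phi> (f i) (ys ! i)))"
    by (intro solved_sum finite_lessThan measurable_compose[OF measurable_draw \<phi>]) auto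
  also have "\<dots> = (\<Sum>i<s. solved s c (\<lambda>f ys. \<phi> (f 0) (ys ! 0)))"
    by (intro sum.cong refl solved_symmetric[symmetric] c \<phi>) auto
  also have "\<dots> = of_nat s * solved s c (\<lambda>f ys. \<phi> (f 0) (ys ! 0))" by simp
  finally have "solved s c (\<lambda>f ys. \<phi> (f 0) (ys ! 0)) = solved s c (\<lambda>f ys. \<Sum>i<s. \<phi> (f i) (ys ! i)) / of_nat s"
    using s by (simp add: mult_divide_eq_ennreal mult.commute[of "of_nat s"] ennreal_of_nat_eq_real_of_nat
        mult.commute[of "ennreal _"])
  moreover have "solved s c (\<lambda>f ys. \<phi> (f 0) (hd ys)) = solved s c (\<lambda>f ys. \<phi> (f 0) (ys ! 0))"
  proof (rule solved_cong[where Q = "\<lambda>_. True"])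
    fix f ys assume "ys \<in> set_pmf (S (map f [0..<s]) c)"
    from solver_assignment[OF exact this] s show "\<phi> (f 0) (hd ys) = \<phi> (f 0) (ys ! 0)"
      using hd_assignment[of ys s] by simp
  qed simp
  ultimately show ?thesis by simp
qed

text \<open>
  Defined through the reward of the solver's output, which equals \<open>opt_value\<close> for nonnegative
  items and capacities, and is measurable in the items by assumption on the solver.
\<close>

definition mean_opt :: "nat \<Rightarrow> real ^ 'd \<Rightarrow> ennreal" where
  "mean_opt s c = solved s c (\<lambda>f ys. ennreal (reward (map f [0..<s]) ys))"

lemma solver_mean_reward:
  assumes "\<forall>i<s. nonneg_item (f i)" "\<And>k. 0 \<le> c $ k"
  shows "(\<integral>\<^sup>+ys. ennreal (reward (map f [0..<s]) ys) \<partial>measure_pmf (S (map f [0..<s]) c))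
    = ennreal (opt_value (map f [0..<s]) c)"
proof -
  have v: "valid_instance (map f [0..<s]) c" by (rule valid_instanceI) (use assms in auto)
  have "(\<integral>\<^sup>+ys. ennreal (reward (map f [0..<s]) ys) \<partial>measure_pmf (S (map f [0..<s]) c))
    = (\<integral>\<^sup>+ys. ennreal (opt_value (map f [0..<s]) c) \<partial>measure_pmf (S (map f [0..<s]) c))"
    using opt_value_eq_solver_reward[OF exact v]
    by (intro nn_integral_cong_AE) (simp add: AE_measure_pmf_iff)
  then show ?thesis by (simp add: measure_pmf.emeasure_space_1)
qed

lemma solver_gains:
  assumes "\<forall>i<s. nonneg_item (f i)" "\<And>k. 0 \<le> c $ k" "ys \<in> set_pmf (S (map f [0..<s]) c)"
  shows "i < s \<Longrightarrow> 0 \<le> gain (f i) (ys ! i)"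
proof -
  have "nonneg_item \<xi>" if "\<xi> \<in> set (map f [0..<s])" for \<xi>
    using that assms(1) by auto
  from solver_gain_nonneg[OF exact this assms(2,3)] show "i < s \<Longrightarrow> 0 \<le> gain (f i) (ys ! i)" by simp
qed

lemma solved_first_gain:
  assumes c: "\<And>k. 0 \<le> c $ k" and s: "0 < s"
  shows "solved s c (\<lambda>f ys. ennreal (gain (f 0) (hd ys))) = mean_opt s c / of_nat s"
proof -
  have "solved s c (\<lambda>f ys. ennreal (gain (f 0) (hd ys)))
      = solved s c (\<lambda>f ys. \<Sum>i<s. ennreal (gain (f i) (ys ! i))) / of_nat s"
    by (rule solved_first[OF c s]) measurable
  also have "solved s c (\<lambda>f ys. \<Sum>i<s. ennreal (gain (f i) (ys ! i))) = mean_opt s c"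
    unfolding mean_opt_def
    by (rule solved_cong[OF AE_nonneg])
      (auto simp: reward_def solver_gains[OF _ c] intro!: sum_ennreal)
  finally show ?thesis .
qed

lemma mean_opt_mono:
  assumes c: "\<And>k. 0 \<le> c $ k" and le: "\<And>k. c $ k \<le> c' $ k"
  shows "mean_opt s c \<le> mean_opt s c'"
  unfolding mean_opt_def solved_def
proof (rule nn_integral_mono_AE, use AE_PiM_all[OF finite_lessThan AE_nonneg, of s] in eventually_elim)
  case (elim f)
  then have f: "\<forall>i<s. nonneg_item (f i)" by auto
  have c': "0 \<le> c' $ k" for k using c[of k] le[of k] by linarith
  have v: "valid_instance (map f [0..<s]) c" "valid_instance (map f [0..<s]) c'"
    by (rule valid_instanceI; use f c c' in auto)+
  obtain xs ys where xs: "xs \<in> set_pmf (S (map f [0..<s]) c)" and ys: "ys \<in> set_pmf (S (map f [0..<s]) c')"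
    using set_pmf_not_empty by (metis ex_in_conv)
  have "xs \<in> feasible (map f [0..<s]) c'"
    using solver_optimal(1)[OF exact v(1) xs] feasible_mono[OF le] by blast
  then have "opt_value (map f [0..<s]) c \<le> opt_value (map f [0..<s]) c'"
    using solver_optimal(2)[OF exact v(2) ys] opt_value_eq_solver_reward[OF exact v(1) xs]
      opt_value_eq_solver_reward[OF exact v(2) ys] by simp
  then show ?case
    unfolding solver_mean_reward[OF f c] solver_mean_reward[OF f c'] by (rule ennreal_leI)
qed

section \<open>Expected reward of the algorithm and of the optimum\<close>

lemma staged_mono:
  assumes n: "n \<le> T"
    and h: "\<And>c R. (\<And>k. 0 \<le> c $ k) \<Longrightarrow> 0 \<le> R \<Longrightarrow> h (c, R) \<le> h' (c, R)"
  shows "staged n h \<le> staged n h'"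
  unfolding staged_def
proof (rule nn_integral_mono_AE, use AE_PiM_all[OF finite_rows AE_nonneg, of n] in eventually_elim)
  case (elim \<omega>)
  show ?case
  proof (rule nn_integral_mono_AE, unfold AE_measure_pmf_iff, intro ballI)
    fix xs assume "xs \<in> set_pmf (oso S b T \<omega> n)"
    then have "(\<forall>k. 0 \<le> fst (state b n \<omega> xs) $ k) \<and> 0 \<le> snd (state b n \<omega> xs)"
      using elim by (intro oso_state_nonneg[OF exact capacity_nonneg n]) (auto simp: rows_def)
    then show "h (state b n \<omega> xs) \<le> h' (state b n \<omega> xs)"
      using h[of "fst (state b n \<omega> xs)" "snd (state b n \<omega> xs)"] by simp
  qed
qed

lemma measurable_staged_integrand:
  assumes "n \<le> T" "h \<in> borel_measurable borel"
  shows "(\<lambda>\<omega>. \<integral>\<^sup>+xs. h (state b n \<omega> xs) \<partial>measure_pmf (oso S b T \<omega> n)) \<in> borel_measurable (\<Pi>\<^sub>M i\<in>rows n. D)"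
  by (intro measurable_nn_integral_oso measurable_compose[OF measurable_state assms(2)] assms(1) order_refl)

lemma staged_add:
  assumes "n \<le> T" "h \<in> borel_measurable borel" "h' \<in> borel_measurable borel"
  shows "staged n (\<lambda>x. h x + h' x) = staged n h + staged n h'"
  unfolding staged_def using assms by (simp add: nn_integral_add measurable_staged_integrand)

lemma staged_cmult:
  assumes "n \<le> T" "h \<in> borel_measurable borel"
  shows "staged n (\<lambda>x. a * h x) = a * staged n h"
  unfolding staged_def using assms by (simp add: nn_integral_cmult measurable_staged_integrand)

lemma staged_const: "staged n (\<lambda>_. a) = a"
proof -
  interpret P: prob_space "\<Pi>\<^sub>M i\<in>rows n. D" by (intro prob_space_PiM prob_space_axioms)
  show ?thesis unfolding staged_def by (simp add: P.emeasure_space_1)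
qed

lemma staged_0: "staged 0 h = h (b, 0)"
proof -
  interpret P: prob_space "\<Pi>\<^sub>M i\<in>rows 0. D" by (intro prob_space_PiM prob_space_axioms)
  show ?thesis by (simp add: staged_def state_def consumption_def reward_def P.emeasure_space_1)
qed

definition at_least :: "real ^ 'd \<Rightarrow> (real ^ 'd) \<times> real \<Rightarrow> ennreal" where
  "at_least \<beta> x = (if \<forall>k. \<beta> $ k \<le> fst x $ k then 1 else 0)"

lemma measurable_component: "(\<lambda>x. fst x $ k) \<in> borel_measurable (borel :: ((real ^ 'd) \<times> real) measure)"
  by (intro borel_measurable_continuous_onI continuous_intros)

lemma measurable_at_least: "at_least \<beta> \<in> borel_measurable borel"
proof -
  have "{x. \<forall>k. \<beta> $ k \<le> fst x $ k} \<in> sets (borel :: ((real ^ 'd) \<times> real) measure)"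
    using measurable_component by measurable
  then show ?thesis unfolding at_least_def[abs_def] by (intro measurable_If measurable_const) auto
qed

text \<open>
  The expected reward of a step is \<open>mean_opt s c / s\<close> at the current capacity \<open>c\<close>, and
  \<open>mean_opt\<close> is monotone. Passing to a fixed threshold \<open>\<beta>\<close> separates the law of the remaining
  capacity from the optimum of the fresh items.
\<close>

lemma reward_step:
  assumes n: "n < T" and \<beta>: "\<And>k. 0 \<le> \<beta> $ k"
  shows "staged n (\<lambda>(c, R). ennreal R) + staged n (at_least \<beta>) * (mean_opt (T - n) \<beta> / of_nat (T - n))
    \<le> staged (Suc n) (\<lambda>(c, R). ennreal R)"
proof -
  let ?s = "T - n" and ?g = "mean_opt (T - n) \<beta> / of_nat (T - n)"
  have m: "(\<lambda>(c :: real ^ 'd, R). ennreal R) \<in> borel_measurable borel"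
    unfolding case_prod_unfold
    by (intro measurable_compose[OF borel_measurable_continuous_onI measurable_ennreal] continuous_intros)
  have "staged n (\<lambda>(c, R). ennreal R) + staged n (at_least \<beta>) * ?g
      = staged n (\<lambda>x. (case x of (c, R) \<Rightarrow> ennreal R) + ?g * at_least \<beta> x)"
    using n m measurable_at_least
    by (subst staged_add) (auto simp: staged_cmult mult.commute[of "staged n (at_least \<beta>)"])
  also have "\<dots> \<le> staged n (\<lambda>(c, R). solved ?s c (\<lambda>f ys. ennreal (R + gain (f 0) (hd ys))))"
  proof (rule staged_mono)
    fix c :: "real ^ 'd" and R :: real
    assume c: "\<And>k. 0 \<le> c $ k" and R: "0 \<le> R"
    have s: "0 < ?s" using n by simp
    have "?g * at_least \<beta> (c, R) \<le> mean_opt ?s c / of_nat ?s"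
      using mean_opt_mono[OF \<beta>, of c ?s] by (simp add: at_least_def divide_right_mono_ennreal)
    also have "\<dots> = solved ?s c (\<lambda>f ys. ennreal (gain (f 0) (hd ys)))"
      by (rule solved_first_gain[OF c s, symmetric])
    finally have "ennreal R + ?g * at_least \<beta> (c, R)
        \<le> solved ?s c (\<lambda>_ _. ennreal R) + solved ?s c (\<lambda>f ys. ennreal (gain (f 0) (hd ys)))"
      by (simp add: solved_const add_left_mono)
    also have "\<dots> = solved ?s c (\<lambda>f ys. ennreal R + ennreal (gain (f 0) (hd ys)))"
      using s by (intro solved_add[symmetric] measurable_const measurable_compose[OF _ measurable_ennreal]
        measurable_compose[OF measurable_draw measurable_gain]) auto
    also have "\<dots> \<le> solved ?s c (\<lambda>f ys. ennreal (R + gain (f 0) (hd ys)))"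
    proof (rule solved_mono[OF AE_nonneg])
      fix f ys assume f: "\<forall>i<?s. nonneg_item (f i)" and ys: "ys \<in> set_pmf (S (map f [0..<?s]) c)"
      have "hd ys = ys ! 0" using hd_assignment[of ys ?s] solver_assignment[OF exact ys] s by simp
      then have "0 \<le> gain (f 0) (hd ys)" using solver_gains[OF f c ys s] by simp
      then show "ennreal R + ennreal (gain (f 0) (hd ys)) \<le> ennreal (R + gain (f 0) (hd ys))"
        using R by simp
    qed
    finally show "(case (c, R) of (c, R) \<Rightarrow> ennreal R) + ?g * at_least \<beta> (c, R)
        \<le> (case (c, R) of (c, R) \<Rightarrow> solved ?s c (\<lambda>f ys. ennreal (R + gain (f 0) (hd ys))))"
      by simp
  qed (use n in simp)
  also have "\<dots> = staged (Suc n) (\<lambda>(c, R). ennreal R)"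
    by (subst staged_Suc[OF n m]) simp
  finally show ?thesis .
qed

lemma reward_lower_bound:
  assumes \<beta>: "\<And>s k. 0 \<le> \<beta> s $ k"
  shows "(\<Sum>s=1..T. staged (T - s) (at_least (\<beta> s)) * (mean_opt s (\<beta> s) / of_nat s))
    \<le> staged T (\<lambda>(c, R). ennreal R)"
proof -
  have "(\<Sum>n<m. staged n (at_least (\<beta> (T - n))) * (mean_opt (T - n) (\<beta> (T - n)) / of_nat (T - n)))
      \<le> staged m (\<lambda>(c, R). ennreal R)" if "m \<le> T" for m
    using that
  proof (induction m)
    case (Suc m)
    then show ?case
      using reward_step[of m "\<beta> (T - m)", OF _ \<beta>] by (auto intro: order_trans[OF add_right_mono])
  qed simp
  from this[of T] show ?thesis
    by (subst sum.reindex_bij_witness[of _ "\<lambda>n. T - n" "\<lambda>s. T - s" "{..<T}"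
      "\<lambda>n. staged n (at_least (\<beta> (T - n))) * (mean_opt (T - n) (\<beta> (T - n)) / of_nat (T - n))"]) auto
qed

lemma integrable_arrival_norm:
  assumes "i < T"
  shows "integrable (\<Pi>\<^sub>M i\<in>rows T. D) (\<lambda>\<omega>. norm (fst (\<omega> (Suc i, Suc i))))"
proof -
  have j: "(Suc i, Suc i) \<in> rows T" using assms by (auto simp: rows_def)
  have "distr (\<Pi>\<^sub>M i\<in>rows T. D) D (\<lambda>\<omega>. \<omega> (Suc i, Suc i)) = D"
    by (rule distr_PiM_component[OF _ j]) (rule prob_space_axioms)
  then have "integrable (distr (\<Pi>\<^sub>M i\<in>rows T. D) D (\<lambda>\<omega>. \<omega> (Suc i, Suc i))) (\<lambda>\<xi>. norm (fst \<xi>))"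
    using integrable_norm[OF integrable_rewards] by simp
  then show ?thesis
    by (rule integrable_distr[OF measurable_component_singleton[OF j]])
qed

text \<open>
  The total reward is bounded by the sum of the norms of the reward vectors, which is integrable;
  the real and the extended expectation therefore agree.
\<close>

lemma expected_oso_eq:
  "0 \<le> expected_oso D S b T" "ennreal (expected_oso D S b T) = staged T (\<lambda>(c, R). ennreal R)"
proof -
  let ?P = "\<Pi>\<^sub>M i\<in>rows T. D"
  define r where "r \<omega> = (\<integral>xs. reward (arrivals T \<omega>) xs \<partial>measure_pmf (oso S b T \<omega> T))" for \<omega>
  have supp: "set_pmf (oso S b T \<omega> T) \<subseteq> assignments T" for \<omega>
    using oso_support[OF exact order_refl] by blast
  have r: "r \<omega> = (\<Sum>xs\<in>assignments T. pmf (oso S b T \<omega> T) xs * reward (arrivals T \<omega>) xs)" for \<omega>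
    unfolding r_def using supp[of \<omega>]
    by (subst integral_measure_pmf[OF finite_assignments[of T]]) auto
  have pmf_measurable: "(\<lambda>\<omega>. pmf (oso S b T \<omega> T) xs) \<in> borel_measurable ?P" for xs
  proof -
    have "(\<lambda>\<omega>. \<integral>\<^sup>+ys. indicator {xs} ys \<partial>measure_pmf (oso S b T \<omega> T)) \<in> borel_measurable ?P"
      by (intro measurable_nn_integral_oso) auto
    then have "(\<lambda>\<omega>. enn2real (ennreal (pmf (oso S b T \<omega> T) xs))) \<in> borel_measurable ?P"
      by (intro borel_measurable_enn2real) (simp add: emeasure_pmf_single)
    then show ?thesis by simp
  qed
  have "(\<lambda>\<omega>. snd (state b T \<omega> xs)) \<in> borel_measurable ?P" for xs
    by (intro measurable_compose[OF measurable_state borel_measurable_continuous_onI] continuous_intros) auto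
  then have r_measurable: "r \<in> borel_measurable ?P"
    unfolding r[abs_def] state_def snd_conv
    by (intro borel_measurable_sum borel_measurable_times pmf_measurable)
  have bound: "\<bar>reward (arrivals T \<omega>) xs\<bar> \<le> (\<Sum>i<T. norm (fst (\<omega> (Suc i, Suc i))))" if "xs \<in> assignments T" for \<omega> xs
  proof -
    have "\<bar>reward (arrivals T \<omega>) xs\<bar> \<le> (\<Sum>i<T. \<bar>gain (\<omega> (Suc i, Suc i)) (xs ! i)\<bar>)"
      unfolding reward_def length_arrivals by (rule order_trans[OF sum_abs]) (simp add: arrivals_nth)
    also have "\<dots> \<le> (\<Sum>i<T. norm (fst (\<omega> (Suc i, Suc i))))"
    proof (rule sum_mono)
      fix i assume "i \<in> {..<T}"
      then have "norm (xs ! i) \<le> 1" using nth_assignment[OF that] norm_Delta_le by auto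
      then show "\<bar>gain (\<omega> (Suc i, Suc i)) (xs ! i)\<bar> \<le> norm (fst (\<omega> (Suc i, Suc i)))"
        by (intro order_trans[OF Cauchy_Schwarz_ineq2] mult_right_le_one_le) auto
    qed
    finally show ?thesis .
  qed
  have r_integrable: "integrable ?P r"
  proof (rule Bochner_Integration.integrable_bound)
    show "integrable ?P (\<lambda>\<omega>. \<Sum>i<T. norm (fst (\<omega> (Suc i, Suc i))))"
      by (intro Bochner_Integration.integrable_sum integrable_arrival_norm) auto
    have "\<bar>r \<omega>\<bar> \<le> (\<Sum>i<T. norm (fst (\<omega> (Suc i, Suc i))))" for \<omega>
    proof -
      let ?B = "\<Sum>i<T. norm (fst (\<omega> (Suc i, Suc i)))"
      have "\<bar>r \<omega>\<bar> \<le> (\<Sum>xs\<in>assignments T. pmf (oso S b T \<omega> T) xs * ?B)"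
        unfolding r using bound
        by (intro order_trans[OF sum_abs] sum_mono) (auto simp: abs_mult intro!: mult_left_mono)
      also have "\<dots> = ?B"
        using sum_pmf_eq_1[OF finite_assignments supp] by (simp add: sum_distrib_right[symmetric])
      finally show ?thesis .
    qed
    then show "AE \<omega> in ?P. norm (r \<omega>) \<le> norm (\<Sum>i<T. norm (fst (\<omega> (Suc i, Suc i))))"
      by (intro AE_I2) (simp add: sum_nonneg)
  qed (rule r_measurable)
  have AE_r: "AE \<omega> in ?P. 0 \<le> r \<omega> \<and>
      ennreal (r \<omega>) = (\<integral>\<^sup>+xs. ennreal (snd (state b T \<omega> xs)) \<partial>measure_pmf (oso S b T \<omega> T))"
    using AE_PiM_all[OF finite_rows AE_nonneg, of T]
  proof eventually_elim
    case (elim \<omega>)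
    have "0 \<le> snd (state b T \<omega> xs)" if "xs \<in> set_pmf (oso S b T \<omega> T)" for xs
      using oso_state_nonneg[OF exact capacity_nonneg order_refl _ that] elim by (auto simp: rows_def)
    then have nn: "AE xs in measure_pmf (oso S b T \<omega> T). 0 \<le> reward (arrivals T \<omega>) xs"
      by (simp add: AE_measure_pmf_iff state_def)
    have "(\<integral>\<^sup>+xs. ennreal (reward (arrivals T \<omega>) xs) \<partial>measure_pmf (oso S b T \<omega> T)) = ennreal (r \<omega>)"
      unfolding r_def
      by (intro nn_integral_eq_integral nn integrable_measure_pmf_finite finite_subset[OF supp finite_assignments])
    then show ?case
      using integral_nonneg_AE[OF nn] by (simp add: r_def state_def)
  qed
  have eo: "expected_oso D S b T = integral\<^sup>L ?P r"
    unfolding expected_oso_def item_space_eq r_def[abs_def] by simp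
  show "0 \<le> expected_oso D S b T"
    unfolding eo using AE_r by (intro integral_nonneg_AE) (auto elim: AE_mp)
  have "ennreal (expected_oso D S b T) = (\<integral>\<^sup>+\<omega>. ennreal (r \<omega>) \<partial>?P)"
    unfolding eo using AE_r by (intro nn_integral_eq_integral[symmetric] r_integrable) (auto elim: AE_mp)
  also have "\<dots> = staged T (\<lambda>(c, R). ennreal R)"
    unfolding staged_def case_prod_unfold
    by (rule nn_integral_cong_AE) (use AE_r in eventually_elim, blast)
  finally show "ennreal (expected_oso D S b T) = staged T (\<lambda>(c, R). ennreal R)" .
qed

lemma expected_opt_le: "ennreal (expected_opt D b T) \<le> mean_opt T b"
proof (cases "integrable (item_space D T) (\<lambda>\<omega>. opt_value (arrivals T \<omega>) b)")
  case False
  \<comment> \<open>the Bochner integral of a function that is not integrable is \<open>0\<close>\<close>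
  then show ?thesis by (simp add: expected_opt_def not_integrable_integral_eq)
next
  case True
  let ?P = "\<Pi>\<^sub>M i\<in>rows T. D"
  let ?\<Phi> = "\<lambda>f. \<integral>\<^sup>+ys. ennreal (reward (map f [0..<T]) ys) \<partial>measure_pmf (S (map f [0..<T]) b)"
  let ?e = "\<lambda>i. (Suc i, Suc i)"
  have m: "?\<Phi> \<in> borel_measurable (draws T)"
    unfolding reward_def
    by (intro measurable_solved_integrand measurable_compose[OF _ measurable_ennreal] borel_measurable_sum)
      (auto intro!: measurable_compose[OF measurable_draw measurable_gain])
  have arr: "arrivals T \<omega> = map (\<lambda>i. \<omega> (?e i)) [0..<T]" for \<omega> :: "nat \<times> nat \<Rightarrow> ('m, 'd) item"
    by (rule nth_equalityI) (auto simp: arrivals_nth)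
  have opt: "AE \<omega> in ?P. 0 \<le> opt_value (arrivals T \<omega>) b
      \<and> ennreal (opt_value (arrivals T \<omega>) b) = ?\<Phi> (restrict (\<lambda>i. \<omega> (?e i)) {..<T})"
    using AE_PiM_all[OF finite_rows AE_nonneg, of T]
  proof eventually_elim
    case (elim \<omega>)
    then have f: "\<forall>i<T. nonneg_item (\<omega> (?e i))" by (auto simp: rows_def)
    let ?items = "map (\<lambda>i. \<omega> (?e i)) [0..<T]"
    have v: "valid_instance ?items b" by (rule valid_instanceI) (use f capacity_nonneg in auto)
    obtain ys where ys: "ys \<in> set_pmf (S ?items b)" using set_pmf_not_empty by (metis ex_in_conv)
    have "0 \<le> reward ?items ys"
      unfolding reward_def using solver_gains[OF f capacity_nonneg ys] by (intro sum_nonneg) auto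
    then have "0 \<le> opt_value ?items b" using opt_value_eq_solver_reward[OF exact v ys] by simp
    then show ?case
      unfolding arr map_restrict_upt using solver_mean_reward[OF f capacity_nonneg] by simp
  qed
  have "ennreal (expected_opt D b T) = (\<integral>\<^sup>+\<omega>. ennreal (opt_value (arrivals T \<omega>) b) \<partial>?P)"
    using True opt unfolding expected_opt_def item_space_eq
    by (intro nn_integral_eq_integral[symmetric]) (auto elim: AE_mp)
  also have "\<dots> = (\<integral>\<^sup>+\<omega>. ?\<Phi> (restrict (\<lambda>i. \<omega> (?e i)) {..<T}) \<partial>?P)"
    by (rule nn_integral_cong_AE) (use opt in eventually_elim, blast)
  also have "\<dots> = mean_opt T b"
    unfolding mean_opt_def solved_def
    by (rule nn_integral_draws_reindex[OF _ _ m, symmetric]) (auto simp: inj_on_def rows_def)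
  finally show ?thesis by simp
qed

end

section \<open>Concentration of the remaining capacity\<close>

text \<open>Every capacity suffices for at least \<open>M\<close> items of largest consumption.\<close>

locale scarce_allocation = allocation D S b T
  for D :: "('m::finite, 'd::finite) item measure" and S b T +
  fixes M :: real
  assumes M_pos: "0 < M"
    and AE_small: "AE \<xi> in D. \<forall>j k. M * snd \<xi> $ j $ k \<le> b $ k"
begin

definition small_item :: "('m, 'd) item \<Rightarrow> bool" where
  "small_item \<xi> \<longleftrightarrow> nonneg_item \<xi> \<and> (\<forall>j k. M * snd \<xi> $ j $ k \<le> b $ k)"

lemma AE_small_item: "AE \<xi> in D. small_item \<xi>"
  using AE_nonneg AE_small unfolding small_item_def by eventually_elim auto

lemma usage_small_item:
  assumes "small_item \<xi>" "y \<in> Delta"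
  shows "0 \<le> usage \<xi> y $ k" "usage \<xi> y $ k \<le> b $ k / M"
proof -
  show "0 \<le> usage \<xi> y $ k" using assms by (intro usage_nonneg) (auto simp: small_item_def)
  have "snd \<xi> $ j $ k \<le> b $ k / M" for j
    using assms(1) M_pos by (simp add: small_item_def pos_le_divide_eq mult.commute)
  then show "usage \<xi> y $ k \<le> b $ k / M"
    using assms(2) M_pos capacity_nonneg[of k] by (intro usage_le) auto
qed

text \<open>
  Consumption in the units in which every capacity is \<open>M\<close>. If \<open>b $ k = 0\<close>, then small items do not
  consume resource \<open>k\<close>, and division by zero gives the correct load \<open>0\<close>.
\<close>

definition load :: "'d \<Rightarrow> ('m, 'd) item \<Rightarrow> real ^ 'm \<Rightarrow> real" where
  "load k \<xi> y = M * usage \<xi> y $ k / b $ k"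

lemma load_small_item:
  assumes "small_item \<xi>" "y \<in> Delta"
  shows "0 \<le> load k \<xi> y" "load k \<xi> y \<le> 1"
proof -
  show "0 \<le> load k \<xi> y"
    using usage_small_item[OF assms, of k] M_pos capacity_nonneg[of k] unfolding load_def by simp
  show "load k \<xi> y \<le> 1"
    using usage_small_item(2)[OF assms, of k] M_pos capacity_nonneg[of k]
    unfolding load_def by (cases "b $ k = 0") (auto simp: field_simps)
qed

lemma borel_measurable_load: "(\<lambda>\<xi>. load k \<xi> y) \<in> borel_measurable D"
proof -
  have "(\<lambda>\<xi>. usage \<xi> y $ k) \<in> borel_measurable D"
    by (intro measurable_compose[OF measurable_usage] borel_measurable_continuous_onI continuous_intros)
  then show ?thesis unfolding load_def by measurable
qed

lemma sum_load_le:
  assumes "b $ k > 0"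
    and "(\<Sum>i\<in>N. usage (f i) (x i) $ k) \<le> c $ k"
  shows "(\<Sum>i\<in>N. load k (f i) (x i)) \<le> M * c $ k / b $ k"
proof -
  have "(\<Sum>i\<in>N. load k (f i) (x i)) = M / b $ k * (\<Sum>i\<in>N. usage (f i) (x i) $ k)"
    by (simp add: load_def sum_distrib_left)
  also have "\<dots> \<le> M / b $ k * c $ k" using assms M_pos by (intro mult_left_mono) auto
  finally show ?thesis by simp
qed

text \<open>
  By symmetry the first item uses on average at most the fraction \<open>1/s\<close> of the remaining
  capacity.
\<close>

lemma mean_load:
  assumes c: "\<And>k. 0 \<le> c $ k" and s: "0 < s" and k: "0 < b $ k"
  shows "solved s c (\<lambda>f ys. ennreal (load k (f 0) (hd ys))) \<le> ennreal (M * c $ k / b $ k / real s)"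
proof -
  have "solved s c (\<lambda>f ys. ennreal (load k (f 0) (hd ys)))
      = solved s c (\<lambda>f ys. \<Sum>i<s. ennreal (load k (f i) (ys ! i))) / of_nat s"
    by (rule solved_first[OF c s]) (intro measurable_compose[OF borel_measurable_load measurable_ennreal])
  also have "solved s c (\<lambda>f ys. \<Sum>i<s. ennreal (load k (f i) (ys ! i)))
      \<le> solved s c (\<lambda>_ _. ennreal (M * c $ k / b $ k))"
  proof (rule solved_mono[OF AE_small_item])
    fix f ys assume f: "\<forall>i<s. small_item (f i)" and ys: "ys \<in> set_pmf (S (map f [0..<s]) c)"
    have "valid_instance (map f [0..<s]) c"
      by (rule valid_instanceI) (use f c in \<open>auto simp: small_item_def\<close>)
    from solver_optimal(1)[OF exact this ys]
    have "(\<Sum>i<s. usage (f i) (ys ! i) $ k) \<le> c $ k" and ys': "ys \<in> assignments s"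
      unfolding feasible_def consumption_nth by auto
    from sum_load_le[OF k this(1)] have "ennreal (\<Sum>i<s. load k (f i) (ys ! i)) \<le> ennreal (M * c $ k / b $ k)"
      by (rule ennreal_leI)
    moreover have "(\<Sum>i<s. ennreal (load k (f i) (ys ! i))) = ennreal (\<Sum>i<s. load k (f i) (ys ! i))"
      using f nth_assignment[OF ys'] by (intro sum_ennreal load_small_item) auto
    ultimately show "(\<Sum>i<s. ennreal (load k (f i) (ys ! i))) \<le> ennreal (M * c $ k / b $ k)" by simp
  qed
  also have "\<dots> = ennreal (M * c $ k / b $ k)" by (rule solved_const)
  finally have "solved s c (\<lambda>f ys. ennreal (load k (f 0) (hd ys))) \<le> ennreal (M * c $ k / b $ k) / of_nat s"
    by (simp add: divide_right_mono_ennreal)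
  also have "\<dots> = ennreal (M * c $ k / b $ k / real s)"
    using s c[of k] k M_pos by (simp add: ennreal_of_nat_eq_real_of_nat divide_ennreal)
  finally show ?thesis .
qed

text \<open>
  Large when resource \<open>k\<close> runs low, so that its expectation bounds the probability of this by
  Markov's inequality.
\<close>

definition potential :: "'d \<Rightarrow> real \<Rightarrow> (real ^ 'd) \<times> real \<Rightarrow> ennreal" where
  "potential k \<theta> x = ennreal (exp (- \<theta> * (M * fst x $ k / b $ k)))"

lemma measurable_potential: "potential k \<theta> \<in> borel_measurable borel"
  unfolding potential_def[abs_def] divide_inverse
  by (intro measurable_compose[OF borel_measurable_continuous_onI measurable_ennreal] continuous_intros)

lemma potential_antimono:
  assumes "0 \<le> fst x $ k" "\<theta> \<le> \<theta>'"
  shows "potential k \<theta>' x \<le> potential k \<theta> x"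
proof -
  have "\<theta> * (M * fst x $ k / b $ k) \<le> \<theta>' * (M * fst x $ k / b $ k)"
    using assms M_pos capacity_nonneg[of k] by (intro mult_right_mono) auto
  then show ?thesis unfolding potential_def by (intro ennreal_leI) simp
qed

text \<open>
  If \<open>X\<close> is the remaining capacity and \<open>u \<in> [0, 1]\<close> the load of the arriving item, then
  \<open>exp (\<theta> u) \<le> 1 + (\<theta> + \<theta>\<^sup>2) u\<close>, and \<open>u\<close> has mean at most \<open>X/s\<close>. So one step multiplies the
  potential by at most \<open>1 + (\<theta> + \<theta>\<^sup>2) X/s\<close> on average, which the smaller parameter absorbs.
\<close>

lemma potential_step:
  assumes n: "n < T" and k: "0 < b $ k" and \<theta>: "0 \<le> \<theta>" "\<theta> \<le> 1"
  shows "staged (Suc n) (potential k \<theta>) \<le> staged n (potential k (\<theta> - (\<theta> + \<theta>\<^sup>2) / real (T - n)))"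
proof -
  let ?s = "T - n"
  have s: "0 < ?s" using n by simp
  have "staged (Suc n) (potential k \<theta>) = staged n (\<lambda>(c, R). solved ?s c (\<lambda>f ys.
      potential k \<theta> (c - usage (f 0) (hd ys), R + gain (f 0) (hd ys))))"
    by (rule staged_Suc[OF n measurable_potential])
  also have "\<dots> \<le> staged n (potential k (\<theta> - (\<theta> + \<theta>\<^sup>2) / real ?s))"
  proof (rule staged_mono)
    fix c :: "real ^ 'd" and R :: real
    assume c: "\<And>k. 0 \<le> c $ k"
    define X where "X = M * c $ k / b $ k"
    have X: "0 \<le> X" using c[of k] k M_pos by (simp add: X_def)
    have "solved ?s c (\<lambda>f ys. potential k \<theta> (c - usage (f 0) (hd ys), R + gain (f 0) (hd ys)))
      \<le> solved ?s c (\<lambda>f ys. ennreal (exp (- \<theta> * X)) + ennreal (exp (- \<theta> * X) * (\<theta> + \<theta>\<^sup>2)) * ennreal (load k (f 0) (hd ys)))"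
    proof (rule solved_mono[OF AE_small_item])
      fix f ys assume f: "\<forall>i<?s. small_item (f i)" and ys: "ys \<in> set_pmf (S (map f [0..<?s]) c)"
      have y: "hd ys \<in> Delta" using hd_assignment[of ys ?s] solver_assignment[OF exact ys] s by simp
      note u = load_small_item[OF f[rule_format, OF s] y, of k]
      have "- \<theta> * (M * (c - usage (f 0) (hd ys)) $ k / b $ k) = - \<theta> * X + \<theta> * load k (f 0) (hd ys)"
        using k by (simp add: load_def X_def field_simps)
      then have "exp (- \<theta> * (M * (c - usage (f 0) (hd ys)) $ k / b $ k)) = exp (- \<theta> * X) * exp (\<theta> * load k (f 0) (hd ys))"
        by (simp only: exp_add)
      also have "\<dots> \<le> exp (- \<theta> * X) * (1 + (\<theta> + \<theta>\<^sup>2) * load k (f 0) (hd ys))"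
      proof (rule mult_left_mono)
        have "exp (\<theta> * load k (f 0) (hd ys)) \<le> 1 + (exp \<theta> - 1) * load k (f 0) (hd ys)"
          by (rule exp_chord[OF u])
        also have "\<dots> \<le> 1 + (\<theta> + \<theta>\<^sup>2) * load k (f 0) (hd ys)"
          using exp_bound[OF \<theta>] u by (intro add_left_mono mult_right_mono) auto
        finally show "exp (\<theta> * load k (f 0) (hd ys)) \<le> 1 + (\<theta> + \<theta>\<^sup>2) * load k (f 0) (hd ys)" .
      qed simp
      finally have "exp (- \<theta> * (M * (c - usage (f 0) (hd ys)) $ k / b $ k))
          \<le> exp (- \<theta> * X) + exp (- \<theta> * X) * (\<theta> + \<theta>\<^sup>2) * load k (f 0) (hd ys)"
        by (simp add: algebra_simps)
      then show "potential k \<theta> (c - usage (f 0) (hd ys), R + gain (f 0) (hd ys))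
          \<le> ennreal (exp (- \<theta> * X)) + ennreal (exp (- \<theta> * X) * (\<theta> + \<theta>\<^sup>2)) * ennreal (load k (f 0) (hd ys))"
        using u \<theta> unfolding potential_def fst_conv
        by (simp add: ennreal_mult[symmetric] ennreal_plus[symmetric] ennreal_leI del: ennreal_plus mult_minus_left)
    qed
    also have "\<dots> = ennreal (exp (- \<theta> * X)) + ennreal (exp (- \<theta> * X) * (\<theta> + \<theta>\<^sup>2)) * solved ?s c (\<lambda>f ys. ennreal (load k (f 0) (hd ys)))"
    proof -
      have m: "(\<lambda>f. ennreal (load k (f 0) (hd ys))) \<in> borel_measurable (draws ?s)" for ys
        using s by (intro measurable_compose[OF _ measurable_ennreal] measurable_compose[OF measurable_draw borel_measurable_load])
      show ?thesis
        by (subst solved_add) (auto simp: solved_const solved_cmult m intro: borel_measurable_times_ennreal m)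
    qed
    also have "\<dots> \<le> ennreal (exp (- \<theta> * X)) + ennreal (exp (- \<theta> * X) * (\<theta> + \<theta>\<^sup>2)) * ennreal (X / real ?s)"
      unfolding X_def by (intro add_left_mono mult_left_mono mean_load[OF c s k]) simp
    also have "\<dots> = ennreal (exp (- \<theta> * X) + exp (- \<theta> * X) * (\<theta> + \<theta>\<^sup>2) * (X / real ?s))"
      using X \<theta> by (simp add: ennreal_mult[symmetric] ennreal_plus[symmetric] del: ennreal_plus mult_minus_left)
    also have "\<dots> = ennreal (exp (- \<theta> * X) * (1 + (\<theta> + \<theta>\<^sup>2) / real ?s * X))"
      by (rule arg_cong[of _ _ ennreal]) (simp add: algebra_simps add_divide_distrib)
    also have "\<dots> \<le> ennreal (exp (- \<theta> * X) * exp ((\<theta> + \<theta>\<^sup>2) / real ?s * X))"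
      by (intro ennreal_leI mult_left_mono exp_ge_add_one_self) simp
    also have "\<dots> = potential k (\<theta> - (\<theta> + \<theta>\<^sup>2) / real ?s) (c, R)"
      by (simp add: potential_def X_def exp_add[symmetric] algebra_simps)
    finally show "(case (c, R) of (c, R) \<Rightarrow> solved ?s c (\<lambda>f ys.
      potential k \<theta> (c - usage (f 0) (hd ys), R + gain (f 0) (hd ys))))
      \<le> potential k (\<theta> - (\<theta> + \<theta>\<^sup>2) / real ?s) (c, R)" by simp
  qed (use n in simp)
  finally show ?thesis .
qed

text \<open>
  With \<open>\<theta> = \<kappa>\<^sub>s / s\<close> the parameter change of a single step reads
  \<open>\<kappa>\<^bsub>s+1\<^esub> = \<kappa>\<^sub>s - \<kappa>\<^sub>s\<^sup>2 / s\<^sup>2\<close>. Bounding \<open>\<kappa>\<^sub>s\<close> by \<open>\<kappa>\<close> in the square and \<open>1 / s\<^sup>2\<close> by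
  \<open>2 / s - 2 / (s + 1)\<close> makes the losses telescope.
\<close>

lemma potential_chain:
  assumes k: "0 < b $ k" and \<kappa>: "0 \<le> \<kappa>" "2 * \<kappa> \<le> real s\<^sub>0" and s: "1 \<le> s\<^sub>0" "s\<^sub>0 \<le> s" "s \<le> T"
  shows "staged (T - s\<^sub>0) (potential k (\<kappa> / real s\<^sub>0))
    \<le> staged (T - s) (potential k ((\<kappa> - \<kappa>\<^sup>2 * (2 / real s\<^sub>0 - 2 / real s)) / real s))"
  using s(2,3)
proof (induction s rule: dec_induct)
  case (step s)
  define \<kappa>s where "\<kappa>s = \<kappa> - \<kappa>\<^sup>2 * (2 / real s\<^sub>0 - 2 / real s)"
  define \<kappa>s' where "\<kappa>s' = \<kappa> - \<kappa>\<^sup>2 * (2 / real s\<^sub>0 - 2 / real (Suc s))"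
  define \<theta> where "\<theta> = \<kappa>s / real s"
  have s0: "0 < real s\<^sub>0" "0 < real s" "real s\<^sub>0 \<le> real s" using s(1) step.hyps by auto
  have le: "\<kappa>s \<le> \<kappa>"
    using s0 by (auto simp: \<kappa>s_def intro!: mult_nonneg_nonneg divide_left_mono)
  \<comment> \<open>the condition \<open>2 \<kappa> \<le> s\<^sub>0\<close> keeps all parameters in \<open>[0, 1]\<close>, where \<open>potential_step\<close> applies\<close>
  have ge: "0 \<le> \<kappa>s"
  proof -
    have "\<kappa>\<^sup>2 * (2 / real s\<^sub>0 - 2 / real s) \<le> \<kappa>\<^sup>2 * (2 / real s\<^sub>0)"
      by (intro mult_left_mono) auto
    also have "\<dots> = \<kappa> * (2 * \<kappa> / real s\<^sub>0)" by (simp add: power2_eq_square)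
    also have "\<dots> \<le> \<kappa> * 1" using \<kappa> s0 by (intro mult_left_mono) auto
    finally show ?thesis by (simp add: \<kappa>s_def)
  qed
  have \<theta>: "0 \<le> \<theta>" "\<theta> \<le> 1" using ge le \<kappa> s0 by (auto simp: \<theta>_def)
  have T: "T - Suc s < T" "Suc (T - Suc s) = T - s" "T - (T - Suc s) = Suc s" using step.prems by auto
  have "staged (T - s\<^sub>0) (potential k (\<kappa> / real s\<^sub>0)) \<le> staged (T - s) (potential k \<theta>)"
    using step.IH step.prems by (simp add: \<theta>_def \<kappa>s_def)
  also have "\<dots> \<le> staged (T - Suc s) (potential k (\<theta> - (\<theta> + \<theta>\<^sup>2) / real (Suc s)))"
    using potential_step[OF T(1) k \<theta>] unfolding T .
  also have "\<dots> \<le> staged (T - Suc s) (potential k (\<kappa>s' / real (Suc s)))"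
  proof (rule staged_mono)
    have "\<kappa>s' = \<kappa>s - 2 * \<kappa>\<^sup>2 / (real s * real (Suc s))"
      using s0 by (simp add: \<kappa>s'_def \<kappa>s_def divide_simps) (simp add: algebra_simps)
    also have "\<dots> \<le> \<kappa>s - \<kappa>\<^sup>2 / (real s)\<^sup>2"
    proof -
      have "real s * real (Suc s) \<le> 2 * (real s)\<^sup>2"
        using step.hyps s(1) by (simp add: power2_eq_square)
      then have "2 / (2 * (real s)\<^sup>2) \<le> 2 / (real s * real (Suc s))"
        using s0 by (intro divide_left_mono) auto
      then have "1 / (real s)\<^sup>2 \<le> 2 / (real s * real (Suc s))" by simp
      from mult_left_mono[OF this, of "\<kappa>\<^sup>2"] show ?thesis by (simp add: mult.commute)
    qed
    also have "\<dots> \<le> \<kappa>s - \<theta>\<^sup>2"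
      using power_mono[OF le ge, of 2] s0 by (simp add: \<theta>_def power_divide divide_right_mono)
    also have "\<dots> = real (Suc s) * \<theta> - (\<theta> + \<theta>\<^sup>2)" using s0 by (simp add: \<theta>_def field_simps)
    finally have "\<kappa>s' / real (Suc s) \<le> \<theta> - (\<theta> + \<theta>\<^sup>2) / real (Suc s)"
      using divide_right_mono[of \<kappa>s' "real (Suc s) * \<theta> - (\<theta> + \<theta>\<^sup>2)" "real (Suc s)"]
      by (simp add: diff_divide_distrib del: of_nat_Suc)
    then show "potential k (\<theta> - (\<theta> + \<theta>\<^sup>2) / real (Suc s)) (c, R) \<le> potential k (\<kappa>s' / real (Suc s)) (c, R)"
      if "\<And>k. 0 \<le> c $ k" "0 \<le> R" for c :: "real ^ 'd" and R :: real
      using that by (intro potential_antimono) auto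
  qed simp
  finally show ?case by (simp add: \<kappa>s'_def)
qed simp

text \<open>
  Markov's inequality for the potential with parameter \<open>\<eta>/4\<close>. With \<open>\<mu> = M s/T\<close> the exponent is
  at most \<open>- (\<eta>/4) (\<eta> - \<eta>/2) \<mu> = - \<eta>\<^sup>2 \<mu> / 8\<close>.
\<close>

lemma capacity_tail:
  assumes s: "1 \<le> s" "s \<le> T" and \<eta>: "0 < \<eta>" "\<eta> \<le> 1" "16 * L \<le> \<eta>\<^sup>2 * (M * real s / real T)"
  shows "staged (T - s) (\<lambda>x. if fst x $ k < (1 - \<eta>) * real s / real T * b $ k then 1 else 0) \<le> ennreal (exp (- 2 * L))"
proof (cases "b $ k = 0")
  case True
  then have "staged (T - s) (\<lambda>x. if fst x $ k < (1 - \<eta>) * real s / real T * b $ k then 1 else 0) \<le> staged (T - s) (\<lambda>_. 0)"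
    by (intro staged_mono) (auto simp: not_less)
  then show ?thesis by (simp add: staged_const)
next
  case False
  then have k: "0 < b $ k" using capacity_nonneg[of k] by simp
  define \<theta> where "\<theta> = \<eta> / 4"
  define \<mu> where "\<mu> = M * real s / real T"
  define \<kappa> where "\<kappa> = \<theta> * real s"
  define \<kappa>T where "\<kappa>T = \<kappa> - \<kappa>\<^sup>2 * (2 / real s - 2 / real T)"
  have pos: "0 < real s" "0 < real T" using s by auto
  have \<theta>: "0 < \<theta>" "\<theta> \<le> 1 / 4" using \<eta> by (auto simp: \<theta>_def)
  let ?ind = "\<lambda>x :: (real ^ 'd) \<times> real. if fst x $ k < (1 - \<eta>) * real s / real T * b $ k then 1 else (0 :: ennreal)"
  have "staged (T - s) ?ind \<le> staged (T - s) (\<lambda>x. ennreal (exp (\<theta> * ((1 - \<eta>) * \<mu>))) * potential k \<theta> x)"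
  proof (rule staged_mono)
    fix c :: "real ^ 'd" and R :: real
    show "?ind (c, R) \<le> ennreal (exp (\<theta> * ((1 - \<eta>) * \<mu>))) * potential k \<theta> (c, R)"
    proof (cases "c $ k < (1 - \<eta>) * real s / real T * b $ k")
      case True
      then have "M * (c $ k / b $ k) \<le> M * ((1 - \<eta>) * real s / real T)"
        using k M_pos by (intro mult_left_mono) (auto simp: field_simps)
      then have "0 \<le> \<theta> * ((1 - \<eta>) * \<mu> - M * c $ k / b $ k)"
        using \<theta> by (intro mult_nonneg_nonneg) (auto simp: \<mu>_def algebra_simps)
      then have "1 \<le> exp (\<theta> * ((1 - \<eta>) * \<mu> - M * c $ k / b $ k))" by simp
      also have "\<dots> = exp (\<theta> * ((1 - \<eta>) * \<mu>)) * exp (- \<theta> * (M * c $ k / b $ k))"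
        by (simp add: exp_add[symmetric] algebra_simps)
      finally have "ennreal 1 \<le> ennreal (exp (\<theta> * ((1 - \<eta>) * \<mu>)) * exp (- \<theta> * (M * c $ k / b $ k)))"
        by (rule ennreal_leI)
      then show ?thesis using True by (simp add: potential_def ennreal_mult)
    qed simp
  qed (use s in simp)
  also have "\<dots> = ennreal (exp (\<theta> * ((1 - \<eta>) * \<mu>))) * staged (T - s) (potential k \<theta>)"
    by (intro staged_cmult measurable_potential) simp
  also have "staged (T - s) (potential k \<theta>) \<le> staged (T - T) (potential k (\<kappa>T / real T))"
    using potential_chain[OF k, of \<kappa> s T] \<theta> s pos unfolding \<kappa>T_def by (simp add: \<kappa>_def)
  also have "\<dots> = ennreal (exp (- (\<kappa>T / real T) * M))"
    using k by (simp add: staged_0 potential_def)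
  also have "ennreal (exp (\<theta> * ((1 - \<eta>) * \<mu>))) * \<dots> = ennreal (exp (\<theta> * ((1 - \<eta>) * \<mu>) - \<kappa>T * M / real T))"
    by (simp add: ennreal_mult[symmetric] exp_add[symmetric])
  also have "\<dots> \<le> ennreal (exp (- 2 * L))"
  proof (rule ennreal_leI, unfold exp_le_cancel_iff)
    have "\<kappa>\<^sup>2 * (2 / real s - 2 / real T) \<le> \<kappa>\<^sup>2 * (2 / real s)"
      by (intro mult_left_mono) auto
    also have "\<dots> = 2 * \<theta>\<^sup>2 * real s" using pos by (simp add: \<kappa>_def power2_eq_square)
    finally have "(\<theta> - 2 * \<theta>\<^sup>2) * real s \<le> \<kappa>T" by (simp add: \<kappa>T_def \<kappa>_def algebra_simps)
    then have "(\<theta> - 2 * \<theta>\<^sup>2) * real s * (M / real T) \<le> \<kappa>T * (M / real T)"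
      using M_pos by (intro mult_right_mono) auto
    then have "(\<theta> - 2 * \<theta>\<^sup>2) * \<mu> \<le> \<kappa>T * M / real T" by (simp add: \<mu>_def mult_ac)
    moreover have "\<theta> * ((1 - \<eta>) * \<mu>) - (\<theta> - 2 * \<theta>\<^sup>2) * \<mu> = - (\<eta>\<^sup>2 * \<mu>) / 8"
      by (simp add: \<theta>_def power2_eq_square field_simps)
    ultimately show "\<theta> * ((1 - \<eta>) * \<mu>) - \<kappa>T * M / real T \<le> - 2 * L"
      using \<eta>(3)[folded \<mu>_def] by (simp only: mult_minus_left)
  qed
  finally show ?thesis by (simp add: mult_left_mono)
qed

lemma capacity_concentration:
  assumes s: "1 \<le> s" "s \<le> T" and \<eta>: "0 < \<eta>" "\<eta> \<le> 1" "16 * L \<le> \<eta>\<^sup>2 * (M * real s / real T)"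
  shows "ennreal (1 - real CARD('d) * exp (- 2 * L))
    \<le> staged (T - s) (at_least (\<chi> k. (1 - \<eta>) * real s / real T * b $ k))"
proof -
  let ?\<beta> = "\<chi> k. (1 - \<eta>) * real s / real T * b $ k"
  let ?bad = "\<lambda>k (x :: (real ^ 'd) \<times> real). if fst x $ k < (1 - \<eta>) * real s / real T * b $ k then 1 else (0 :: ennreal)"
  have m: "?bad k \<in> borel_measurable borel" for k
  proof -
    have "{x \<in> space borel. fst x $ k < (1 - \<eta>) * real s / real T * b $ k} \<in> sets (borel :: ((real ^ 'd) \<times> real) measure)"
      using measurable_component[of k] unfolding borel_measurable_iff_less by blast
    then show ?thesis by (auto intro!: measurable_If)
  qed
  have "1 = staged (T - s) (\<lambda>_. 1)" by (simp add: staged_const)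
  also have "\<dots> \<le> staged (T - s) (\<lambda>x. at_least ?\<beta> x + (\<Sum>k\<in>UNIV. ?bad k x))"
  proof (rule staged_mono)
    fix c :: "real ^ 'd" and R :: real
    show "1 \<le> at_least ?\<beta> (c, R) + (\<Sum>k\<in>UNIV. ?bad k (c, R))"
    proof (cases "\<forall>k. ?\<beta> $ k \<le> c $ k")
      case False
      then obtain k where "c $ k < (1 - \<eta>) * real s / real T * b $ k" by (auto simp: not_le)
      then have "1 \<le> ?bad k (c, R)" by simp
      also have "\<dots> \<le> (\<Sum>k\<in>UNIV. ?bad k (c, R))" by (rule member_le_sum) auto
      finally show ?thesis by (simp add: add_increasing)
    qed (simp add: at_least_def)
  qed (use s in simp)
  also have "\<dots> = staged (T - s) (at_least ?\<beta>) + staged (T - s) (\<lambda>x. \<Sum>k\<in>UNIV. ?bad k x)"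
    by (intro staged_add measurable_at_least borel_measurable_sum m) simp
  also have "staged (T - s) (\<lambda>x. \<Sum>k\<in>UNIV. ?bad k x) = (\<Sum>k\<in>UNIV. staged (T - s) (?bad k))"
  proof -
    have "staged (T - s) (\<lambda>x. \<Sum>k\<in>K. ?bad k x) = (\<Sum>k\<in>K. staged (T - s) (?bad k))" if "finite K" for K
      using that
    proof (induction K rule: finite_induct)
      case (insert k K)
      have "staged (T - s) (\<lambda>x. ?bad k x + (\<Sum>k\<in>K. ?bad k x)) = staged (T - s) (?bad k) + staged (T - s) (\<lambda>x. \<Sum>k\<in>K. ?bad k x)"
        by (intro staged_add borel_measurable_sum m) simp
      then show ?case using insert by simp
    qed (simp add: staged_const)
    then show ?thesis by simp
  qed
  also have "\<dots> \<le> (\<Sum>k\<in>(UNIV :: 'd set). ennreal (exp (- 2 * L)))"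
    by (intro sum_mono capacity_tail[OF s \<eta>])
  also have "\<dots> = ennreal (real CARD('d) * exp (- 2 * L))"
    by (simp add: ennreal_of_nat_eq_real_of_nat ennreal_mult)
  finally have "1 \<le> ennreal (real CARD('d) * exp (- 2 * L)) + staged (T - s) (at_least ?\<beta>)"
    by (simp add: add.commute add_left_mono)
  then show ?thesis
    by (subst ennreal_minus[symmetric]) (auto simp: ennreal_minus_le_iff)
qed

section \<open>Comparison with the optimum for all items\<close>

text \<open>
  Each of the \<open>T - s\<close> past items used at most \<open>b $ k / M\<close> of resource \<open>k\<close>.
\<close>

lemma capacity_sure:
  assumes s: "1 \<le> s" "s \<le> T" and M: "real T \<le> M"
  shows "1 \<le> staged (T - s) (at_least (\<chi> k. real s * (b $ k / M)))"
proof -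
  let ?n = "T - s"
  interpret P: prob_space "\<Pi>\<^sub>M i\<in>rows ?n. D" by (intro prob_space_PiM prob_space_axioms)
  have "1 = (\<integral>\<^sup>+\<omega>. 1 \<partial>(\<Pi>\<^sub>M i\<in>rows ?n. D))" by (simp add: P.emeasure_space_1)
  also have "\<dots> \<le> staged ?n (at_least (\<chi> k. real s * (b $ k / M)))"
    unfolding staged_def
  proof (rule nn_integral_mono_AE, use AE_PiM_all[OF finite_rows AE_small_item, of ?n] in eventually_elim)
    case (elim \<omega>)
    have "1 = (\<integral>\<^sup>+xs. 1 \<partial>measure_pmf (oso S b T \<omega> ?n))" by (simp add: measure_pmf.emeasure_space_1)
    also have "\<dots> \<le> (\<integral>\<^sup>+xs. at_least (\<chi> k. real s * (b $ k / M)) (state b ?n \<omega> xs) \<partial>measure_pmf (oso S b T \<omega> ?n))"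
    proof (rule nn_integral_mono_AE, unfold AE_measure_pmf_iff, intro ballI)
      fix xs assume xs: "xs \<in> set_pmf (oso S b T \<omega> ?n)"
      have xs': "xs \<in> assignments ?n" by (rule oso_support[OF exact _ xs]) simp
      have "real s * (b $ k / M) \<le> fst (state b ?n \<omega> xs) $ k" for k
      proof -
        have "consumption (arrivals ?n \<omega>) xs $ k \<le> (\<Sum>i<?n. b $ k / M)"
          unfolding consumption_nth length_arrivals
        proof (rule sum_mono)
          fix i assume i: "i \<in> {..<?n}"
          then have "small_item (\<omega> (Suc i, Suc i))" using elim by (auto simp: rows_def)
          then show "usage (arrivals ?n \<omega> ! i) (xs ! i) $ k \<le> b $ k / M"
            using i nth_assignment[OF xs'] by (simp add: arrivals_nth usage_small_item)
        qed
        also have "\<dots> = (real T - real s) * (b $ k / M)" using s by (simp add: of_nat_diff)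
        also have "\<dots> = real T * (b $ k / M) - real s * (b $ k / M)" by (rule left_diff_distrib)
        also have "real T * (b $ k / M) \<le> M * (b $ k / M)"
          using M M_pos capacity_nonneg[of k] by (intro mult_right_mono) auto
        also have "\<dots> = b $ k" using M_pos by simp
        finally show ?thesis by (simp add: state_def)
      qed
      then show "1 \<le> at_least (\<chi> k. real s * (b $ k / M)) (state b ?n \<omega> xs)" by (simp add: at_least_def)
    qed
    finally show ?case .
  qed
  finally show ?thesis .
qed

text \<open>
  What an assignment for all items yields when only the items in \<open>N\<close> are served, provided that these
  fit into the capacity \<open>\<beta>\<close>.
\<close>

definition kept :: "nat set \<Rightarrow> real ^ 'd \<Rightarrow> (nat \<Rightarrow> ('m, 'd) item) \<Rightarrow> (real ^ 'm) list \<Rightarrow> ennreal" where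
  "kept N \<beta> f xs = (if \<forall>k. (\<Sum>i\<in>N. usage (f i) (xs ! i) $ k) \<le> \<beta> $ k
     then ennreal (\<Sum>i\<in>N. gain (f i) (xs ! i)) else 0)"

lemma measurable_kept:
  assumes "N \<subseteq> {..<T}"
  shows "(\<lambda>f. kept N \<beta> f xs) \<in> borel_measurable (draws T)"
proof -
  have d: "(\<lambda>f. f i) \<in> measurable (draws T) D" if "i \<in> N" for i
    using that assms by (intro measurable_draw) auto
  have u: "(\<lambda>f. usage (f i) (xs ! i) $ k) \<in> borel_measurable (draws T)" if "i \<in> N" for i k
    by (intro measurable_compose[OF measurable_compose[OF d[OF that] measurable_usage]]
      borel_measurable_continuous_onI continuous_intros)
  have g: "(\<lambda>f. gain (f i) (xs ! i)) \<in> borel_measurable (draws T)" if "i \<in> N" for i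
    by (rule measurable_compose[OF d[OF that] measurable_gain])
  have [measurable]: "(\<lambda>f. \<Sum>i\<in>N. usage (f i) (xs ! i) $ k) \<in> borel_measurable (draws T)"
    "(\<lambda>f. \<Sum>i\<in>N. gain (f i) (xs ! i)) \<in> borel_measurable (draws T)" for k
    by (intro borel_measurable_sum u g; assumption)+
  show ?thesis unfolding kept_def by measurable
qed

text \<open>
  Any \<open>s\<close> of \<open>T\<close> i.i.d. items are distributed like \<open>s\<close> items of their own. For a choice
  that includes \<open>N\<close>, the optimum of the chosen items is at least the kept value.
\<close>

lemma mean_opt_ge_kept:
  assumes N: "N \<subseteq> {..<T}" "card N \<le> s" and s: "s \<le> T" and \<beta>: "\<And>k. 0 \<le> \<beta> $ k"
  shows "solved T b (kept N \<beta>) \<le> mean_opt s \<beta>"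
proof -
  \<comment> \<open>the pool of \<open>s\<close> items: those of \<open>N\<close> and any others\<close>
  obtain N' where N': "N \<subseteq> N'" "N' \<subseteq> {..<T}" "card N' = s"
    using exists_subset_between[of N s "{..<T}"] N s by auto
  obtain e where e: "bij_betw e {..<s} N'"
    using ex_bij_betw_nat_finite[of N'] N' finite_subset[OF N'(2)] by (auto simp: lessThan_atLeast0)
  then have e': "inj_on e {..<s}" "e ` {..<s} = N'" by (auto simp: bij_betw_def)
  let ?\<Phi> = "\<lambda>f. \<integral>\<^sup>+ys. ennreal (reward (map f [0..<s]) ys) \<partial>measure_pmf (S (map f [0..<s]) \<beta>)"
  have m: "?\<Phi> \<in> borel_measurable (draws s)"
    unfolding reward_def
    by (intro measurable_solved_integrand measurable_compose[OF _ measurable_ennreal] borel_measurable_sum)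
      (auto intro!: measurable_compose[OF measurable_draw measurable_gain])
  have "solved T b (kept N \<beta>) \<le> (\<integral>\<^sup>+f. ?\<Phi> (restrict (\<lambda>i. f (e i)) {..<s}) \<partial>draws T)"
    unfolding solved_def
  proof (rule nn_integral_mono_AE, use AE_PiM_all[OF finite_lessThan AE_nonneg, of T] in eventually_elim)
    case (elim f)
    let ?items = "map (\<lambda>i. f (e i)) [0..<s]"
    have f: "\<forall>i<s. nonneg_item (f (e i))" using elim e'(2) N' by auto
    have "(\<integral>\<^sup>+xs. kept N \<beta> f xs \<partial>measure_pmf (S (map f [0..<T]) b))
      \<le> (\<integral>\<^sup>+xs. ennreal (opt_value ?items \<beta>) \<partial>measure_pmf (S (map f [0..<T]) b))"
    proof (rule nn_integral_mono_AE, unfold AE_measure_pmf_iff, intro ballI)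
      fix xs assume xs: "xs \<in> set_pmf (S (map f [0..<T]) b)"
      have xs': "xs \<in> assignments T" using solver_assignment[OF exact xs] by simp
      obtain ys where ys: "ys \<in> set_pmf (S ?items \<beta>)" using set_pmf_not_empty by (metis ex_in_conv)
      have v: "valid_instance ?items \<beta>" by (rule valid_instanceI) (use f \<beta> in auto)
      show "kept N \<beta> f xs \<le> ennreal (opt_value ?items \<beta>)"
      proof (cases "\<forall>k. (\<Sum>i\<in>N. usage (f i) (xs ! i) $ k) \<le> \<beta> $ k")
        case True
        have "(\<Sum>i\<in>N. gain (f i) (xs ! i)) \<le> reward ?items ys"
          using N'(1) e' nth_assignment[OF xs'] N(1) True
          by (intro solver_beats_restriction[OF exact f \<beta> e'(1) _ _ _ ys]) auto
        then show ?thesis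
          using True opt_value_eq_solver_reward[OF exact v ys] by (simp add: kept_def ennreal_leI)
      next
        case False
        then show ?thesis by (auto simp: kept_def)
      qed
    qed
    also have "\<dots> = ennreal (opt_value ?items \<beta>)" by (simp add: measure_pmf.emeasure_space_1)
    also have "\<dots> = ?\<Phi> (restrict (\<lambda>i. f (e i)) {..<s})"
      unfolding map_restrict_upt by (rule solver_mean_reward[OF f \<beta>, symmetric])
    finally show ?case .
  qed
  also have "\<dots> = mean_opt s \<beta>"
    unfolding mean_opt_def solved_def
    by (rule nn_integral_draws_reindex[OF e'(1) _ m, symmetric]) (use e' N' in auto)
  finally show ?thesis .
qed

text \<open>
  Serving the first \<open>s\<close> of \<open>T\<close> items as in an optimal solution for \<open>T\<close> items always fits, since they
  use at most \<open>b $ k / M\<close> each; by symmetry this yields the fraction \<open>s/T\<close> of the optimum.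
\<close>

lemma mean_opt_abundant:
  assumes s: "1 \<le> s" "s \<le> T"
  shows "of_nat s * (mean_opt T b / of_nat T) \<le> mean_opt s (\<chi> k. real s * (b $ k / M))"
proof -
  let ?\<beta> = "\<chi> k. real s * (b $ k / M)"
  have T: "0 < T" using s by simp
  have "of_nat s * (mean_opt T b / of_nat T) = (\<Sum>i<s. solved T b (\<lambda>f ys. ennreal (gain (f 0) (hd ys))))"
    by (simp add: solved_first_gain[OF capacity_nonneg T])
  also have "\<dots> = (\<Sum>i<s. solved T b (\<lambda>f ys. ennreal (gain (f i) (ys ! i))))"
  proof (rule sum.cong)
    fix i assume "i \<in> {..<s}"
    then have i: "i < T" using s by auto
    have "solved T b (\<lambda>f ys. ennreal (gain (f 0) (hd ys))) = solved T b (\<lambda>f ys. ennreal (gain (f 0) (ys ! 0)))"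
      using hd_assignment[OF solver_assignment[OF exact]] T
      by (intro solved_cong[where Q = "\<lambda>_. True"]) auto
    also have "\<dots> = solved T b (\<lambda>f ys. ennreal (gain (f i) (ys ! i)))"
      by (rule solved_symmetric[OF capacity_nonneg i]) measurable
    finally show "solved T b (\<lambda>f ys. ennreal (gain (f 0) (hd ys))) = solved T b (\<lambda>f ys. ennreal (gain (f i) (ys ! i)))" .
  qed simp
  also have "\<dots> = solved T b (\<lambda>f ys. \<Sum>i<s. ennreal (gain (f i) (ys ! i)))"
    using s by (intro solved_sum[symmetric] finite_lessThan measurable_compose[OF _ measurable_ennreal]
      measurable_compose[OF measurable_draw measurable_gain]) auto
  also have "\<dots> \<le> solved T b (kept {..<s} ?\<beta>)"
  proof (rule solved_mono[OF AE_small_item])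
    fix f ys assume f: "\<forall>i<T. small_item (f i)" and ys: "ys \<in> set_pmf (S (map f [0..<T]) b)"
    have ys': "ys \<in> assignments T" using solver_assignment[OF exact ys] by simp
    have f': "\<forall>i<T. nonneg_item (f i)" using f by (auto simp: small_item_def)
    have "(\<Sum>i<s. usage (f i) (ys ! i) $ k) \<le> (\<Sum>i<s. b $ k / M)" for k
      using f s nth_assignment[OF ys'] by (intro sum_mono usage_small_item) auto
    moreover have "(\<Sum>i<s. ennreal (gain (f i) (ys ! i))) = ennreal (\<Sum>i<s. gain (f i) (ys ! i))"
      using s by (intro sum_ennreal solver_gains[OF f' capacity_nonneg ys]) auto
    ultimately show "(\<Sum>i<s. ennreal (gain (f i) (ys ! i))) \<le> kept {..<s} ?\<beta> f ys"
      by (simp add: kept_def)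
  qed
  also have "\<dots> \<le> mean_opt s ?\<beta>"
    using s M_pos capacity_nonneg by (intro mean_opt_ge_kept) auto
  finally show ?thesis .
qed

text \<open>
  The number of sampled items is bounded like the consumption of a further resource \<open>None\<close>,
  of which every item uses \<open>1\<close> and \<open>s\<close> units are available. Its concentration needs
  \<open>\<eta>\<^sup>2 s \<ge> 16 L\<close>, which follows from the condition on the other resources because \<open>M \<le> T\<close>.
\<close>

lemma kept_average:
  assumes s: "1 \<le> s" "s \<le> T" and MT: "M \<le> real T"
    and \<eta>: "0 < \<eta>" "\<eta> \<le> 1 / 3" "16 * L \<le> \<eta>\<^sup>2 * (M * real s / real T)" "1 \<le> L"
    and p: "p = (1 - 3 * \<eta>) * real s / real T"
    and f: "\<forall>i<T. small_item (f i)" and xs: "xs \<in> set_pmf (S (map f [0..<T]) b)"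
  shows "ennreal (p * (1 - (real CARD('d) + 1) * exp (- 2 * L))) * ennreal (reward (map f [0..<T]) xs)
    \<le> (\<Sum>N\<in>{N\<in>Pow {..<T}. card N \<le> s}. ennreal (sample_weight p {..<T} N)
        * kept N (\<chi> k. (1 - \<eta>) * real s / real T * b $ k) f xs)"
proof -
  let ?I = "{..<T}" and ?\<beta> = "\<chi> k. (1 - \<eta>) * real s / real T * b $ k"
  define w where "w i = gain (f i) (xs ! i)" for i
  define v where "v \<kappa> i = (case \<kappa> of None \<Rightarrow> 1 | Some k \<Rightarrow> load k (f i) (xs ! i))" for \<kappa> i
  define cap where "cap \<kappa> = (case \<kappa> of None \<Rightarrow> real s | Some k \<Rightarrow> (1 - \<eta>) * (M * real s / real T))" for \<kappa> :: "'d option"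
  have pos: "0 < real s" "0 < real T" "real s \<le> real T" using s by auto
  have p01: "0 \<le> p" "p \<le> 1"
  proof -
    show "0 \<le> p" using \<eta> pos by (simp add: p)
    have "(1 - 3 * \<eta>) * real s \<le> 1 * real T" using \<eta> pos by (intro mult_mono) auto
    then show "p \<le> 1" using pos by (simp add: p)
  qed
  have xs': "xs \<in> assignments T" using solver_assignment[OF exact xs] by simp
  have f': "\<forall>i<T. nonneg_item (f i)" using f by (auto simp: small_item_def)
  have w: "0 \<le> w i" if "i \<in> ?I" for i
    using solver_gains[OF f' capacity_nonneg xs] that by (simp add: w_def)
  have "valid_instance (map f [0..<T]) b"
    by (rule valid_instanceI) (use f' capacity_nonneg in auto)
  from solver_optimal(1)[OF exact this xs]
  have fits: "(\<Sum>i<T. usage (f i) (xs ! i) $ k) \<le> b $ k" for k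
    unfolding feasible_def consumption_nth by auto
  have v01: "0 \<le> v \<kappa> i" "v \<kappa> i \<le> 1" if "i \<in> ?I" for \<kappa> i
    using that f nth_assignment[OF xs'] by (auto simp: v_def load_small_item split: option.split)
  have tail: "(\<Sum>N\<in>{N\<in>Pow ?I. i \<in> N \<and> cap \<kappa> < sum (v \<kappa>) N}. sample_weight p ?I N) \<le> p * exp (- 2 * L)"
    if i: "i \<in> ?I" for \<kappa> i
  proof (cases \<kappa>)
    case None
    show ?thesis
    proof (rule sample_tail[OF finite_lessThan i p01 v01 _ _ \<eta>(1,2) _ \<eta>(4)])
      show "p * sum (v \<kappa>) ?I \<le> (1 - 3 * \<eta>) * real s" using None pos by (simp add: v_def p)
      show "(1 - \<eta>) * real s \<le> cap \<kappa>" using None \<eta> by (simp add: cap_def algebra_simps)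
      have "M * real s / real T \<le> real s" using MT pos by (simp add: divide_le_eq mult.commute)
      then have "\<eta>\<^sup>2 * (M * real s / real T) \<le> \<eta>\<^sup>2 * real s" by (intro mult_left_mono) auto
      then show "16 * L \<le> \<eta>\<^sup>2 * real s" using \<eta>(3) by linarith
    qed
  next
    case (Some k)
    show ?thesis
    proof (rule sample_tail[OF finite_lessThan i p01 v01 _ _ \<eta>])
      have "sum (v \<kappa>) ?I \<le> M"
      proof (cases "b $ k = 0")
        case True
        then show ?thesis using Some M_pos by (simp add: v_def load_def)
      next
        case False
        then have k: "0 < b $ k" using capacity_nonneg[of k] by simp
        from sum_load_le[OF k fits] k Some show ?thesis by (simp add: v_def)
      qed
      then have "p * sum (v \<kappa>) ?I \<le> p * M" by (rule mult_left_mono) (rule p01)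
      then show "p * sum (v \<kappa>) ?I \<le> (1 - 3 * \<eta>) * (M * real s / real T)" by (simp add: p mult_ac)
      show "(1 - \<eta>) * (M * real s / real T) \<le> cap \<kappa>" using Some by (simp add: cap_def)
    qed
  qed
  let ?G = "{N\<in>Pow ?I. \<forall>\<kappa>. sum (v \<kappa>) N \<le> cap \<kappa>}"
  have sample: "p * (1 - real CARD('d option) * exp (- 2 * L)) * sum w ?I
      \<le> (\<Sum>N\<in>?G. sample_weight p ?I N * sum w N)"
    by (rule sample_expectation[OF finite_lessThan p01 w tail])
  have kept: "card N \<le> s \<and> kept N ?\<beta> f xs = ennreal (sum w N)" if N: "N \<in> ?G" for N
  proof -
    from N have le: "sum (v \<kappa>) N \<le> cap \<kappa>" for \<kappa> by blast
    have NI: "N \<subseteq> ?I" using N by auto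
    have "(\<Sum>i\<in>N. usage (f i) (xs ! i) $ k) \<le> ?\<beta> $ k" for k
    proof (cases "b $ k = 0")
      case True
      have "(\<Sum>i\<in>N. usage (f i) (xs ! i) $ k) \<le> (\<Sum>i\<in>N. b $ k / M)"
        using f NI nth_assignment[OF xs'] by (intro sum_mono usage_small_item) auto
      then show ?thesis using True by simp
    next
      case False
      then have k: "0 < b $ k" using capacity_nonneg[of k] by simp
      have "M / b $ k * (\<Sum>i\<in>N. usage (f i) (xs ! i) $ k) \<le> M / b $ k * ?\<beta> $ k"
        using le[of "Some k"] k by (simp add: v_def cap_def load_def sum_distrib_left mult_ac)
      then show ?thesis using k M_pos by (subst (asm) mult_le_cancel_left_pos) auto
    qed
    moreover have "card N \<le> s" using le[of None] by (simp add: v_def cap_def)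
    ultimately show ?thesis by (simp add: kept_def w_def)
  qed
  have rw: "reward (map f [0..<T]) xs = sum w ?I" by (simp add: reward_def w_def)
  have mult: "ennreal (a * sum w ?I) = ennreal a * ennreal (sum w ?I)" for a
    by (rule ennreal_mult''[OF sum_nonneg[OF w]])
  have card: "real CARD('d option) = real CARD('d) + 1" by simp
  have "ennreal (p * (1 - (real CARD('d) + 1) * exp (- 2 * L))) * ennreal (reward (map f [0..<T]) xs)
      = ennreal (p * (1 - real CARD('d option) * exp (- 2 * L)) * sum w ?I)"
    by (simp only: mult card rw)
  also have "\<dots> \<le> ennreal (\<Sum>N\<in>?G. sample_weight p ?I N * sum w N)"
    by (rule ennreal_leI[OF sample])
  also have "\<dots> = (\<Sum>N\<in>?G. ennreal (sample_weight p ?I N * sum w N))"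
    using w by (intro sum_ennreal[symmetric] mult_nonneg_nonneg sample_weight_nonneg p01 sum_nonneg) auto
  also have "\<dots> = (\<Sum>N\<in>?G. ennreal (sample_weight p ?I N) * kept N ?\<beta> f xs)"
    using kept w by (intro sum.cong refl) (auto intro!: ennreal_mult sample_weight_nonneg p01 sum_nonneg)
  also have "\<dots> \<le> (\<Sum>N\<in>{N\<in>Pow ?I. card N \<le> s}. ennreal (sample_weight p ?I N) * kept N ?\<beta> f xs)"
    using kept by (intro sum_mono2) auto
  finally show ?thesis .
qed

text \<open>
  The lower bound \<open>mean_opt_ge_kept\<close> holds for every \<open>N\<close> with at most \<open>s\<close> elements, hence for the
  average over random \<open>N\<close>, which can be exchanged with the expectation over the items.
\<close>

lemma mean_opt_scarce:
  assumes s: "1 \<le> s" "s \<le> T" and MT: "M \<le> real T"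
    and \<eta>: "0 < \<eta>" "\<eta> \<le> 1 / 3" "16 * L \<le> \<eta>\<^sup>2 * (M * real s / real T)" "1 \<le> L"
  shows "ennreal ((1 - 3 * \<eta>) * real s / real T * (1 - (real CARD('d) + 1) * exp (- 2 * L))) * mean_opt T b
    \<le> mean_opt s (\<chi> k. (1 - \<eta>) * real s / real T * b $ k)"
proof -
  let ?\<beta> = "\<chi> k. (1 - \<eta>) * real s / real T * b $ k"
  define p where "p = (1 - 3 * \<eta>) * real s / real T"
  let ?W = "\<lambda>N. ennreal (sample_weight p {..<T} N)" and ?A = "{N\<in>Pow {..<T}. card N \<le> s}"
  have p01: "0 \<le> p" "p \<le> 1"
  proof -
    have pos: "0 < real T" "real s \<le> real T" using s by auto
    show "0 \<le> p" using \<eta> pos by (simp add: p_def)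
    have "(1 - 3 * \<eta>) * real s \<le> 1 * real T" using \<eta> pos by (intro mult_mono) auto
    then show "p \<le> 1" using pos by (simp add: p_def)
  qed
  have "ennreal (p * (1 - (real CARD('d) + 1) * exp (- 2 * L))) * mean_opt T b
      = solved T b (\<lambda>f xs. ennreal (p * (1 - (real CARD('d) + 1) * exp (- 2 * L))) * ennreal (reward (map f [0..<T]) xs))"
    unfolding mean_opt_def reward_def
    by (intro solved_cmult[symmetric] measurable_compose[OF _ measurable_ennreal] borel_measurable_sum)
      (auto intro!: measurable_compose[OF measurable_draw measurable_gain])
  also have "\<dots> \<le> solved T b (\<lambda>f xs. \<Sum>N\<in>?A. ?W N * kept N ?\<beta> f xs)"
    by (rule solved_mono[OF AE_small_item kept_average[OF s MT \<eta> p_def]])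
  also have "\<dots> = (\<Sum>N\<in>?A. solved T b (\<lambda>f xs. ?W N * kept N ?\<beta> f xs))"
    by (intro solved_sum borel_measurable_times_ennreal measurable_const measurable_kept) auto
  also have "\<dots> = (\<Sum>N\<in>?A. ?W N * solved T b (kept N ?\<beta>))"
    by (intro sum.cong refl solved_cmult measurable_kept) auto
  also have "\<dots> \<le> (\<Sum>N\<in>?A. ?W N * mean_opt s ?\<beta>)"
    using s \<eta> capacity_nonneg
    by (intro sum_mono mult_left_mono mean_opt_ge_kept) (auto intro!: mult_nonneg_nonneg divide_nonneg_nonneg)
  also have "\<dots> \<le> (\<Sum>N\<in>Pow {..<T}. ?W N * mean_opt s ?\<beta>)"
    by (intro sum_mono2) auto
  also have "\<dots> = ennreal (\<Sum>N\<in>Pow {..<T}. sample_weight p {..<T} N) * mean_opt s ?\<beta>"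
    using p01 by (simp add: sum_distrib_right[symmetric] sum_ennreal sample_weight_nonneg)
  also have "\<dots> = mean_opt s ?\<beta>" by (simp add: sum_sample_weight)
  finally show ?thesis by (simp add: p_def)
qed

text \<open>
  The factors \<open>1 - 3\<eta>\<close>, \<open>1 - d exp (- 2 L)\<close> and \<open>1 - (d + 1) exp (- 2 L)\<close> come from the reduced
  sampling rate, from the concentration of the remaining capacity and from the sampling error.
  If \<open>\<eta> > 1/3\<close>, the bound is trivial because \<open>ennreal\<close> truncates its negative factor to \<open>0\<close>.
\<close>

lemma stage_bound:
  assumes s: "1 \<le> s" "s \<le> T"
    and \<eta>: "0 < \<eta>" "16 * L \<le> \<eta>\<^sup>2 * (M * real s / real T)" "1 \<le> L"
    and \<delta>: "(2 * real CARD('d) + 1) * exp (- 2 * L) \<le> \<delta>" "\<delta> \<le> 1"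
  shows "\<exists>\<beta>. (\<forall>k. 0 \<le> \<beta> $ k) \<and> ennreal ((1 - 3 * \<eta> - \<delta>) / real T) * mean_opt T b
    \<le> staged (T - s) (at_least \<beta>) * (mean_opt s \<beta> / of_nat s)"
proof -
  have pos: "0 < real s" "0 < real T" using s by auto
  let ?x = "exp (- 2 * L)"
  have x: "0 \<le> real CARD('d) * ?x" "0 < ?x" by auto
  have \<delta>0: "0 \<le> \<delta>" by (rule order_trans[OF _ \<delta>(1)]) simp
  \<comment> \<open>if \<open>M \<ge> T\<close>, capacities never bind; otherwise items are subsampled\<close>
  consider "1 / 3 < \<eta>" | "\<eta> \<le> 1 / 3" "real T \<le> M" | "\<eta> \<le> 1 / 3" "M \<le> real T" by linarith
  then show ?thesis
  proof cases
    case 1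
    then have "(1 - 3 * \<eta> - \<delta>) / real T \<le> 0" using \<delta>0 pos by (intro divide_nonpos_pos) auto
    then show ?thesis using capacity_nonneg by (intro exI[of _ b]) (simp add: ennreal_neg)
  next
    case 2
    let ?\<beta> = "\<chi> k. real s * (b $ k / M)"
    have "ennreal ((1 - 3 * \<eta> - \<delta>) / real T) * mean_opt T b \<le> ennreal (1 / real T) * mean_opt T b"
      using \<eta> \<delta>0 pos by (intro mult_right_mono ennreal_leI divide_right_mono) auto
    also have "\<dots> = mean_opt T b / of_nat T"
      using pos by (simp add: divide_ennreal_def ennreal_of_nat_eq_real_of_nat inverse_ennreal inverse_eq_divide mult.commute)
    also have "\<dots> = of_nat s * (mean_opt T b / of_nat T) / of_nat s"
      using pos by (simp add: ennreal_of_nat_eq_real_of_nat mult_divide_eq_ennreal mult.commute[of "ennreal _"])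
    also have "\<dots> \<le> mean_opt s ?\<beta> / of_nat s"
      by (intro divide_right_mono_ennreal mean_opt_abundant s)
    also have "\<dots> = 1 * (mean_opt s ?\<beta> / of_nat s)" by simp
    also have "\<dots> \<le> staged (T - s) (at_least ?\<beta>) * (mean_opt s ?\<beta> / of_nat s)"
      by (intro mult_right_mono capacity_sure s 2) simp
    finally show ?thesis using M_pos capacity_nonneg by (intro exI[of _ ?\<beta>]) simp
  next
    case 3
    let ?\<beta> = "\<chi> k. (1 - \<eta>) * real s / real T * b $ k"
    define y where "y = real CARD('d) * ?x"
    have y: "0 \<le> y" "2 * y + ?x \<le> \<delta>" using \<delta>(1) by (auto simp: y_def algebra_simps)
    have "(1 - 3 * \<eta> - \<delta>) \<le> (1 - 3 * \<eta>) * (1 - \<delta>)"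
      using \<eta> \<delta>0 by (simp add: algebra_simps)
    also have "\<dots> \<le> (1 - 3 * \<eta>) * ((1 - y) * (1 - (y + ?x)))"
    proof (rule mult_left_mono)
      have "1 - \<delta> \<le> 1 - y - (y + ?x)" using y by simp
      also have "\<dots> \<le> (1 - y) * (1 - (y + ?x))" using y x by (simp add: algebra_simps)
      finally show "1 - \<delta> \<le> (1 - y) * (1 - (y + ?x))" .
    qed (use 3 in simp)
    finally have "(1 - 3 * \<eta> - \<delta>) / real T \<le> (1 - 3 * \<eta>) * ((1 - y) * (1 - (y + ?x))) / real T"
      using pos by (intro divide_right_mono) auto
    also have "\<dots> = (1 - y) * ((1 - 3 * \<eta>) * real s / real T * (1 - (y + ?x))) / real s"
      using pos by (simp add: mult_ac)
    finally have le: "(1 - 3 * \<eta> - \<delta>) / real T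
        \<le> (1 - y) * ((1 - 3 * \<eta>) * real s / real T * (1 - (y + ?x))) / real s" .
    have y1: "0 \<le> 1 - y" "0 \<le> 1 - (y + ?x)" using y \<delta>(2) x(2) by linarith+
    have "ennreal ((1 - 3 * \<eta> - \<delta>) / real T) * mean_opt T b
        \<le> ennreal ((1 - y) * ((1 - 3 * \<eta>) * real s / real T * (1 - (y + ?x))) / real s) * mean_opt T b"
      by (intro mult_right_mono ennreal_leI le) simp
    also have "\<dots> = ennreal (1 - y) * (ennreal ((1 - 3 * \<eta>) * real s / real T * (1 - (y + ?x))) * mean_opt T b / of_nat s)"
    proof -
      have a: "0 \<le> (1 - 3 * \<eta>) * real s / real T * (1 - (y + ?x))"
        using y1 3 pos by (intro mult_nonneg_nonneg divide_nonneg_nonneg) auto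
      define z where "z = (1 - 3 * \<eta>) * real s / real T * (1 - (y + ?x))"
      have "ennreal ((1 - y) * z / real s) = ennreal (1 - y) * (ennreal z / of_nat s)"
        using a y1 pos unfolding z_def[symmetric]
        by (simp add: ennreal_of_nat_eq_real_of_nat divide_ennreal ennreal_mult[symmetric])
      then show ?thesis unfolding z_def[symmetric]
        by (simp add: divide_ennreal_def mult_ac)
    qed
    also have "\<dots> \<le> staged (T - s) (at_least ?\<beta>) * (mean_opt s ?\<beta> / of_nat s)"
    proof (intro mult_mono divide_right_mono_ennreal)
      show "ennreal (1 - y) \<le> staged (T - s) (at_least ?\<beta>)"
        unfolding y_def using 3 \<eta> by (intro capacity_concentration s) auto
      have "y + ?x = (real CARD('d) + 1) * ?x" by (simp add: y_def algebra_simps)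
      then show "ennreal ((1 - 3 * \<eta>) * real s / real T * (1 - (y + ?x))) * mean_opt T b \<le> mean_opt s ?\<beta>"
        using mean_opt_scarce[OF s 3(2) \<eta>(1) 3(1) \<eta>(2,3)] by simp
    qed auto
    finally show ?thesis using 3 capacity_nonneg
      by (intro exI[of _ ?\<beta>]) (auto intro!: mult_nonneg_nonneg divide_nonneg_nonneg)
  qed
qed

section \<open>The competitive ratio\<close>

lemma competitive_ratio:
  assumes T: "1 \<le> T" and \<epsilon>: "0 < \<epsilon>" "\<epsilon> \<le> 0.001" and L: "1 \<le> L"
    and M: "65536 * L / \<epsilon>\<^sup>2 \<le> M"
    and \<delta>: "(2 * real CARD('d) + 1) * exp (- 2 * L) \<le> \<epsilon>\<^sup>2"
  shows "expected_oso D S b T \<ge> (1 - \<epsilon>) * expected_opt D b T"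
proof -
  \<comment> \<open>the least \<open>\<eta>\<close> with \<open>16 L \<le> \<eta>\<^sup>2 M s/T\<close> when \<open>M = 65536 L / \<epsilon>\<^sup>2\<close>\<close>
  define \<eta> where "\<eta> s = \<epsilon> / 64 * sqrt (real T / real s)" for s
  have e2: "\<epsilon>\<^sup>2 \<le> \<epsilon> / 1000" using mult_left_mono[OF \<epsilon>(2), of \<epsilon>] \<epsilon> by (simp add: power2_eq_square)
  have "\<exists>\<beta>. (\<forall>k. 0 \<le> \<beta> $ k) \<and> (s \<in> {1..T} \<longrightarrow> ennreal ((1 - 3 * \<eta> s - \<epsilon>\<^sup>2) / real T) * mean_opt T b
      \<le> staged (T - s) (at_least \<beta>) * (mean_opt s \<beta> / of_nat s))" for s
  proof (cases "s \<in> {1..T}")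
    case True
    then have s: "1 \<le> s" "s \<le> T" "0 < real s" "0 < real T" by auto
    have "(\<eta> s)\<^sup>2 * (M * real s / real T) = \<epsilon>\<^sup>2 * M / 4096"
      using s by (simp add: \<eta>_def power_mult_distrib power_divide)
    moreover have "65536 * L \<le> \<epsilon>\<^sup>2 * M" using M \<epsilon> by (simp add: divide_le_eq mult.commute)
    ultimately have "16 * L \<le> (\<eta> s)\<^sup>2 * (M * real s / real T)" by linarith
    moreover have "0 < \<eta> s" using s \<epsilon> by (simp add: \<eta>_def)
    ultimately show ?thesis using stage_bound[of s "\<eta> s" L "\<epsilon>\<^sup>2"] s L \<delta> e2 \<epsilon> by auto
  next
    case False
    then show ?thesis using capacity_nonneg by blast
  qed
  then obtain \<beta> where \<beta>: "\<And>s k. 0 \<le> \<beta> s $ k"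
    "\<And>s. s \<in> {1..T} \<Longrightarrow> ennreal ((1 - 3 * \<eta> s - \<epsilon>\<^sup>2) / real T) * mean_opt T b
      \<le> staged (T - s) (at_least (\<beta> s)) * (mean_opt s (\<beta> s) / of_nat s)"
    by metis
  have "1 - \<epsilon> \<le> (\<Sum>s=1..T. (1 - 3 * \<eta> s - \<epsilon>\<^sup>2) / real T)"
  proof -
    have pos: "0 < real T" "0 < sqrt (real T)" using T by auto
    have "(\<Sum>s=1..T. \<eta> s) = \<epsilon> / 64 * sqrt (real T) * (\<Sum>s=1..T. 1 / sqrt (real s))"
      by (simp add: \<eta>_def real_sqrt_divide sum_distrib_left)
    also have "\<dots> \<le> \<epsilon> / 64 * sqrt (real T) * (2 * sqrt (real T))"
      using \<epsilon> by (intro mult_left_mono sum_inverse_sqrt_le) auto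
    also have "\<dots> = \<epsilon> / 32 * real T" by simp
    finally have "(\<Sum>s=1..T. \<eta> s) \<le> \<epsilon> / 32 * real T" .
    then have "real T * (1 - \<epsilon>) \<le> real T - 3 * (\<Sum>s=1..T. \<eta> s) - real T * \<epsilon>\<^sup>2"
      using mult_left_mono[OF e2, of "real T"] mult_pos_pos[OF pos(1) \<epsilon>(1)] by (simp add: algebra_simps)
    also have "\<dots> = (\<Sum>s=1..T. 1 - 3 * \<eta> s - \<epsilon>\<^sup>2)"
      by (simp add: sum_subtractf sum_distrib_left)
    finally show ?thesis using pos by (simp add: sum_divide_distrib[symmetric] le_divide_eq mult.commute)
  qed
  then have "ennreal (1 - \<epsilon>) * mean_opt T b \<le> ennreal (\<Sum>s=1..T. (1 - 3 * \<eta> s - \<epsilon>\<^sup>2) / real T) * mean_opt T b"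
    by (intro mult_right_mono ennreal_leI) auto
  also have "\<dots> \<le> (\<Sum>s=1..T. ennreal ((1 - 3 * \<eta> s - \<epsilon>\<^sup>2) / real T)) * mean_opt T b"
    by (intro mult_right_mono ennreal_sum_le) auto
  also have "\<dots> = (\<Sum>s=1..T. ennreal ((1 - 3 * \<eta> s - \<epsilon>\<^sup>2) / real T) * mean_opt T b)"
    by (rule sum_distrib_right)
  also have "\<dots> \<le> (\<Sum>s=1..T. staged (T - s) (at_least (\<beta> s)) * (mean_opt s (\<beta> s) / of_nat s))"
    by (intro sum_mono \<beta>(2))
  also have "\<dots> \<le> ennreal (expected_oso D S b T)"
    unfolding expected_oso_eq(2) by (rule reward_lower_bound[OF \<beta>(1)])
  finally have upper: "ennreal (1 - \<epsilon>) * mean_opt T b \<le> ennreal (expected_oso D S b T)" .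
  have "ennreal (1 - \<epsilon>) * ennreal (expected_opt D b T) \<le> ennreal (1 - \<epsilon>) * mean_opt T b"
    by (intro mult_left_mono expected_opt_le) simp
  also note upper
  finally have "ennreal ((1 - \<epsilon>) * expected_opt D b T) \<le> ennreal (expected_oso D S b T)"
    using \<epsilon> by (simp add: ennreal_mult')
  then show ?thesis using expected_oso_eq(1) by (simp add: ennreal_le_iff)
qed

end

theorem theorem1:
  fixes D :: "('m::finite, 'd::finite) item measure"
    and S :: "('m, 'd) solver"
    and b :: "real ^ 'd"
    and T :: nat
    and \<epsilon> :: real
  assumes "prob_space D"
    and "sets D = sets borel"
    and "integrable D fst"
    and "AE \<xi> in D. nonneg_item \<xi>"
    and "\<And>k. 0 \<le> b $ k"
    and "exact_solver S"
    and "equivariant_solver S"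
    and "measurable_solver S"
    and "0 < \<epsilon>" and "\<epsilon> \<le> 0.001"
    and "\<And>\<xi> j k. \<xi> \<in> measure_support D \<Longrightarrow>
           b $ k \<ge> 1024 * ln (2 * real CARD('d) * real T / \<epsilon>)
                     * ((ln (1 / \<epsilon>)) ^ 3 / \<epsilon>\<^sup>2) * snd \<xi> $ j $ k"
  shows "expected_oso D S b T \<ge> (1 - \<epsilon>) * expected_opt D b T"
proof -
  interpret prob_space D by fact
  interpret allocation D S b T by standard (fact assms)+
  show ?thesis
  proof (cases "T = 0")
    case True
    \<comment> \<open>without items the logarithm in the hypothesis is \<open>ln 0\<close>, but all rewards vanish\<close>
    then have "mean_opt T b = solved T b (\<lambda>_ _. 0)" by (simp add: mean_opt_def reward_def)
    also have "\<dots> = 0" by (rule solved_const)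
    finally have "expected_opt D b T \<le> 0" using expected_opt_le by (simp add: ennreal_eq_0_iff)
    then have "(1 - \<epsilon>) * expected_opt D b T \<le> 0" using assms(9,10) by (simp add: mult_nonneg_nonpos)
    then show ?thesis using expected_oso_eq(1) by linarith
  next
    case False
    define L where "L = ln (2 * real CARD('d) * real T / \<epsilon>)"
    define l where "l = ln (1 / \<epsilon>)"
    define M where "M = 1024 * L * (l ^ 3 / \<epsilon>\<^sup>2)"
    define n where "n = real CARD('d) * real T"
    have n: "1 \<le> n" "real CARD('d) \<le> n" "0 < n"
    proof -
      have "CARD('d) * 1 \<le> CARD('d) * T" using False by (intro mult_left_mono) auto
      moreover have "1 \<le> CARD('d)" by (simp add: Suc_leI)
      ultimately have "1 \<le> CARD('d) * T" "CARD('d) \<le> CARD('d) * T" by linarith+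
      then show "1 \<le> n" "real CARD('d) \<le> n" "0 < n"
        unfolding n_def of_nat_mult[symmetric] by linarith+
    qed
    have inv: "1000 \<le> 1 / \<epsilon>" using assms(9,10) by (simp add: field_simps)
    have "1 / \<epsilon> \<le> 2 * n / \<epsilon>" using n assms(9) by (intro divide_right_mono) auto
    then have inv2: "1 / \<epsilon> \<le> 2 * real CARD('d) * real T / \<epsilon>" by (simp add: n_def mult.assoc)
    have exp4: "exp (4 :: real) \<le> 81"
    proof -
      have "exp (4 :: real) = exp 1 ^ 4" by (simp add: exp_of_nat_mult[symmetric])
      also have "\<dots> \<le> 3 ^ 4" using exp_le by (intro power_mono) auto
      finally show ?thesis by simp
    qed
    \<comment> \<open>hence \<open>1024 l\<^sup>3 \<ge> 1024 * 64 = 65536\<close>\<close>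
    have l: "4 \<le> l" unfolding l_def using exp4 inv assms(9) by (subst ln_ge_iff) auto
    have L: "l \<le> L" unfolding l_def L_def using inv inv2 assms(9) by (subst ln_le_cancel_iff) auto
    have l3: "64 \<le> l ^ 3" using power_mono[OF l, of 3] by simp
    have ge: "65536 * L / \<epsilon>\<^sup>2 \<le> M"
    proof -
      have "1024 * L * (64 / \<epsilon>\<^sup>2) \<le> M"
        unfolding M_def using l L l3 by (intro mult_left_mono divide_right_mono) auto
      then show ?thesis by simp
    qed
    have "AE \<xi> in D. \<forall>j k. M * snd \<xi> $ j $ k \<le> b $ k"
      using AE_measure_support[OF assms(2)]
    proof eventually_elim
      case (elim \<xi>)
      then show ?case using assms(11)[OF elim] unfolding M_def L_def l_def by simp
    qed
    moreover have "0 < M" unfolding M_def using l L assms(9) by (intro mult_pos_pos divide_pos_pos) auto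
    ultimately interpret scarce_allocation D S b T M by unfold_locales
    have "exp (- 2 * L) = (\<epsilon> / (2 * n))\<^sup>2"
    proof -
      have "exp (- 2 * L) = inverse (exp L * exp L)" by (simp add: exp_minus[symmetric] exp_add[symmetric])
      also have "exp L = 2 * n / \<epsilon>" unfolding L_def n_def using n assms(9) n_def by (simp add: mult.assoc)
      finally show ?thesis using n assms(9) by (simp add: power2_eq_square field_simps)
    qed
    then have "(2 * real CARD('d) + 1) * exp (- 2 * L) \<le> (4 * n\<^sup>2) * (\<epsilon> / (2 * n))\<^sup>2"
    proof -
      have "2 * real CARD('d) + 1 \<le> 4 * n" using n by simp
      also have "\<dots> \<le> 4 * n\<^sup>2" using n by (simp add: power2_eq_square)
      finally show ?thesis unfolding \<open>exp (- 2 * L) = _\<close> by (intro mult_right_mono) auto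
    qed
    also have "\<dots> = \<epsilon>\<^sup>2" using n by (simp add: power2_eq_square field_simps)
    finally show ?thesis
      using competitive_ratio[of \<epsilon> L] False assms(9,10) l L ge by simp
  qed
qed

end
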